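(* There exists a non-trivial model of dependent type theory with a cumulative hierarchy of universes in the style of Agda, in which, for every level $\ell$, every type $A : \mathcal{U}_\ell$ and every function $f : \mathcal{U}_\ell \to A$, the function $f$ is constant, i.e.\ for all $X, Y : \mathcal{U}_\ell$ the interpretation satisfies $f\,X = f\,Y$.
   Context: Dependent type theory (DTT) here means Martin-Löf-style type theory with dependent function types $(x : A) \to B(x)$ and a hierarchy of universes $\mathcal{U}_\ell$ indexed by levels $\ell \in \mathbb{N}$, where $\mathcal{U}_\ell : \mathcal{U}_{\ell+1}$. "Agda-style cumulativity" means that cumulativity is not implicit subtyping but is given by a lifting operation: for every $X : \mathcal{U}_\ell$ there is a type $\mathrm{Lift}\,X : \mathcal{U}_{\ell+1}$ together with an isomorphism $\mathrm{Lift}\,X \cong X$. A model is non-trivial if it does not identify all terms/types (in particular it is not the model in which every type is a singleton; e.g.\ some type is uninhabited). A function $f : \mathcal{U}_\ell \to A$ is constant if $f\,X$ and $f\,Y$ are equal for all $X, Y : \mathcal{U}_\ell$. Note that the hypothesis $A : \mathcal{U}_\ell$ excludes e.g.\ $A = \mathcal{U}_\ell$ (which lives in $\mathcal{U}_{\ell+1}$), for which the identity function would be a non-constant example. *)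

theory Defs
  imports Main
begin

text \<open>
  Models of dependent type theory are rendered as categories with families (CwFs),
  encoded with untyped carriers and typing predicates:
  'c contexts, 's substitutions, 't types, 'm terms.
  \<open>sub M \<Delta> \<Gamma>\<close> is the set of substitutions from \<Delta> to \<Gamma>;
  \<open>ty M l \<Gamma>\<close> the types of universe level l in context \<Gamma>;
  \<open>tm M \<Gamma> A\<close> the terms of type A in context \<Gamma>.
  \<open>comp M \<sigma> \<tau>\<close> is \<sigma> composed after \<tau>.
\<close>

record ('c, 's, 't, 'm) dtt_struct =
  con   :: "'c set"
  sub   :: "'c \<Rightarrow> 'c \<Rightarrow> 's set"
  ty    :: "nat \<Rightarrow> 'c \<Rightarrow> 't set"
  tm    :: "'c \<Rightarrow> 't \<Rightarrow> 'm set"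
  sid   :: "'c \<Rightarrow> 's"
  comp  :: "'s \<Rightarrow> 's \<Rightarrow> 's"
  tsub  :: "'t \<Rightarrow> 's \<Rightarrow> 't"
  msub  :: "'m \<Rightarrow> 's \<Rightarrow> 'm"
  emp   :: "'c"
  eps   :: "'c \<Rightarrow> 's"
  ext   :: "'c \<Rightarrow> 't \<Rightarrow> 'c"
  wk    :: "'c \<Rightarrow> 't \<Rightarrow> 's"
  vz    :: "'c \<Rightarrow> 't \<Rightarrow> 'm"
  pair  :: "'s \<Rightarrow> 'm \<Rightarrow> 's"
  Pi    :: "'t \<Rightarrow> 't \<Rightarrow> 't"
  lam   :: "'t \<Rightarrow> 't \<Rightarrow> 'm \<Rightarrow> 'm"
  app   :: "'t \<Rightarrow> 't \<Rightarrow> 'm \<Rightarrow> 'm"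
  Univ  :: "'c \<Rightarrow> nat \<Rightarrow> 't"
  code  :: "'t \<Rightarrow> 'm"
  El    :: "'m \<Rightarrow> 't"
  Lift  :: "'t \<Rightarrow> 't"
  up    :: "'m \<Rightarrow> 'm"
  down  :: "'t \<Rightarrow> 'm \<Rightarrow> 'm"

text \<open>Weakening of a substitution along a type: \<sigma>\<up> = \<langle>\<sigma> \<circ> p, q\<rangle> : \<Delta>.A[\<sigma>] \<rightarrow> \<Gamma>.A\<close>
definition lift_sub :: "('c, 's, 't, 'm, 'z) dtt_struct_scheme \<Rightarrow> 'c \<Rightarrow> 't \<Rightarrow> 's \<Rightarrow> 's" where
  "lift_sub M \<Delta> A \<sigma> = pair M (comp M \<sigma> (wk M \<Delta> (tsub M A \<sigma>))) (vz M \<Delta> (tsub M A \<sigma>))"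

definition cwf_base :: "('c, 's, 't, 'm, 'z) dtt_struct_scheme \<Rightarrow> bool" where
  "cwf_base M \<longleftrightarrow>
    (\<forall>\<Delta> \<Gamma> \<sigma>. \<sigma> \<in> sub M \<Delta> \<Gamma> \<longrightarrow> \<Delta> \<in> con M \<and> \<Gamma> \<in> con M) \<and>
    (\<forall>l \<Gamma> A. A \<in> ty M l \<Gamma> \<longrightarrow> \<Gamma> \<in> con M) \<and>
    (\<forall>\<Gamma>. \<Gamma> \<in> con M \<longrightarrow> sid M \<Gamma> \<in> sub M \<Gamma> \<Gamma>) \<and>
    (\<forall>\<Theta> \<Delta> \<Gamma> \<sigma> \<tau>. \<sigma> \<in> sub M \<Delta> \<Gamma> \<and> \<tau> \<in> sub M \<Theta> \<Delta> \<longrightarrow> comp M \<sigma> \<tau> \<in> sub M \<Theta> \<Gamma>) \<and>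
    (\<forall>\<Delta> \<Gamma> \<sigma>. \<sigma> \<in> sub M \<Delta> \<Gamma> \<longrightarrow> comp M (sid M \<Gamma>) \<sigma> = \<sigma> \<and> comp M \<sigma> (sid M \<Delta>) = \<sigma>) \<and>
    (\<forall>\<Xi> \<Theta> \<Delta> \<Gamma> \<sigma> \<tau> \<rho>. \<sigma> \<in> sub M \<Delta> \<Gamma> \<and> \<tau> \<in> sub M \<Theta> \<Delta> \<and> \<rho> \<in> sub M \<Xi> \<Theta> \<longrightarrow>
        comp M (comp M \<sigma> \<tau>) \<rho> = comp M \<sigma> (comp M \<tau> \<rho>)) \<and>
    (\<forall>l \<Delta> \<Gamma> A \<sigma>. A \<in> ty M l \<Gamma> \<and> \<sigma> \<in> sub M \<Delta> \<Gamma> \<longrightarrow> tsub M A \<sigma> \<in> ty M l \<Delta>) \<and>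
    (\<forall>l \<Gamma> A. A \<in> ty M l \<Gamma> \<longrightarrow> tsub M A (sid M \<Gamma>) = A) \<and>
    (\<forall>l \<Theta> \<Delta> \<Gamma> A \<sigma> \<tau>. A \<in> ty M l \<Gamma> \<and> \<sigma> \<in> sub M \<Delta> \<Gamma> \<and> \<tau> \<in> sub M \<Theta> \<Delta> \<longrightarrow>
        tsub M A (comp M \<sigma> \<tau>) = tsub M (tsub M A \<sigma>) \<tau>) \<and>
    (\<forall>l \<Delta> \<Gamma> A t \<sigma>. A \<in> ty M l \<Gamma> \<and> t \<in> tm M \<Gamma> A \<and> \<sigma> \<in> sub M \<Delta> \<Gamma> \<longrightarrow>
        msub M t \<sigma> \<in> tm M \<Delta> (tsub M A \<sigma>)) \<and>
    (\<forall>l \<Gamma> A t. A \<in> ty M l \<Gamma> \<and> t \<in> tm M \<Gamma> A \<longrightarrow> msub M t (sid M \<Gamma>) = t) \<and>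
    (\<forall>l \<Theta> \<Delta> \<Gamma> A t \<sigma> \<tau>. A \<in> ty M l \<Gamma> \<and> t \<in> tm M \<Gamma> A \<and> \<sigma> \<in> sub M \<Delta> \<Gamma> \<and> \<tau> \<in> sub M \<Theta> \<Delta> \<longrightarrow>
        msub M t (comp M \<sigma> \<tau>) = msub M (msub M t \<sigma>) \<tau>)"

definition cwf_ctx :: "('c, 's, 't, 'm, 'z) dtt_struct_scheme \<Rightarrow> bool" where
  "cwf_ctx M \<longleftrightarrow>
    emp M \<in> con M \<and>
    (\<forall>\<Gamma>. \<Gamma> \<in> con M \<longrightarrow> eps M \<Gamma> \<in> sub M \<Gamma> (emp M)) \<and>
    (\<forall>\<Gamma> \<sigma>. \<sigma> \<in> sub M \<Gamma> (emp M) \<longrightarrow> \<sigma> = eps M \<Gamma>) \<and>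
    (\<forall>l \<Gamma> A. A \<in> ty M l \<Gamma> \<longrightarrow>
        ext M \<Gamma> A \<in> con M \<and>
        wk M \<Gamma> A \<in> sub M (ext M \<Gamma> A) \<Gamma> \<and>
        vz M \<Gamma> A \<in> tm M (ext M \<Gamma> A) (tsub M A (wk M \<Gamma> A)) \<and>
        pair M (wk M \<Gamma> A) (vz M \<Gamma> A) = sid M (ext M \<Gamma> A)) \<and>
    (\<forall>l \<Delta> \<Gamma> A \<sigma> t. A \<in> ty M l \<Gamma> \<and> \<sigma> \<in> sub M \<Delta> \<Gamma> \<and> t \<in> tm M \<Delta> (tsub M A \<sigma>) \<longrightarrow>
        pair M \<sigma> t \<in> sub M \<Delta> (ext M \<Gamma> A) \<and>
        comp M (wk M \<Gamma> A) (pair M \<sigma> t) = \<sigma> \<and>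
        msub M (vz M \<Gamma> A) (pair M \<sigma> t) = t) \<and>
    (\<forall>l \<Theta> \<Delta> \<Gamma> A \<sigma> t \<tau>. A \<in> ty M l \<Gamma> \<and> \<sigma> \<in> sub M \<Delta> \<Gamma> \<and> t \<in> tm M \<Delta> (tsub M A \<sigma>) \<and>
        \<tau> \<in> sub M \<Theta> \<Delta> \<longrightarrow>
        comp M (pair M \<sigma> t) \<tau> = pair M (comp M \<sigma> \<tau>) (msub M t \<tau>))"

definition cwf_pi :: "('c, 's, 't, 'm, 'z) dtt_struct_scheme \<Rightarrow> bool" where
  "cwf_pi M \<longleftrightarrow>
    (\<forall>l k \<Gamma> A B. A \<in> ty M l \<Gamma> \<and> B \<in> ty M k (ext M \<Gamma> A) \<longrightarrow>
        Pi M A B \<in> ty M (max l k) \<Gamma> \<and>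
        (\<forall>t. t \<in> tm M (ext M \<Gamma> A) B \<longrightarrow>
             lam M A B t \<in> tm M \<Gamma> (Pi M A B) \<and> app M A B (lam M A B t) = t) \<and>
        (\<forall>f. f \<in> tm M \<Gamma> (Pi M A B) \<longrightarrow>
             app M A B f \<in> tm M (ext M \<Gamma> A) B \<and> lam M A B (app M A B f) = f) \<and>
        (\<forall>\<Delta> \<sigma>. \<sigma> \<in> sub M \<Delta> \<Gamma> \<longrightarrow>
             tsub M (Pi M A B) \<sigma> =
               Pi M (tsub M A \<sigma>) (tsub M B (lift_sub M \<Delta> A \<sigma>)) \<and>
             (\<forall>t. t \<in> tm M (ext M \<Gamma> A) B \<longrightarrow>
                msub M (lam M A B t) \<sigma> =
                  lam M (tsub M A \<sigma>) (tsub M B (lift_sub M \<Delta> A \<sigma>))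
                        (msub M t (lift_sub M \<Delta> A \<sigma>)))))"

text \<open>Universes a la Coquand: U_l : U_(l+1) in every context, codes of level-l types are
  exactly the terms of U_l (El and code mutually inverse), all stable under substitution.\<close>
definition cwf_univ :: "('c, 's, 't, 'm, 'z) dtt_struct_scheme \<Rightarrow> bool" where
  "cwf_univ M \<longleftrightarrow>
    (\<forall>l \<Gamma>. \<Gamma> \<in> con M \<longrightarrow> Univ M \<Gamma> l \<in> ty M (Suc l) \<Gamma>) \<and>
    (\<forall>l \<Delta> \<Gamma> \<sigma>. \<sigma> \<in> sub M \<Delta> \<Gamma> \<longrightarrow> tsub M (Univ M \<Gamma> l) \<sigma> = Univ M \<Delta> l) \<and>
    (\<forall>l \<Gamma> A. A \<in> ty M l \<Gamma> \<longrightarrow>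
        code M A \<in> tm M \<Gamma> (Univ M \<Gamma> l) \<and> El M (code M A) = A) \<and>
    (\<forall>l \<Gamma> a. \<Gamma> \<in> con M \<and> a \<in> tm M \<Gamma> (Univ M \<Gamma> l) \<longrightarrow>
        El M a \<in> ty M l \<Gamma> \<and> code M (El M a) = a) \<and>
    (\<forall>l \<Delta> \<Gamma> a \<sigma>. \<Gamma> \<in> con M \<and> a \<in> tm M \<Gamma> (Univ M \<Gamma> l) \<and> \<sigma> \<in> sub M \<Delta> \<Gamma> \<longrightarrow>
        tsub M (El M a) \<sigma> = El M (msub M a \<sigma>))"

text \<open>Agda-style cumulativity: Lift A : U_(l+1) for A : U_l, with an isomorphism
  (up/down) Tm(Lift A) \<cong> Tm A, natural in the context.\<close>
definition cwf_lift :: "('c, 's, 't, 'm, 'z) dtt_struct_scheme \<Rightarrow> bool" where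
  "cwf_lift M \<longleftrightarrow>
    (\<forall>l \<Gamma> A. A \<in> ty M l \<Gamma> \<longrightarrow>
        Lift M A \<in> ty M (Suc l) \<Gamma> \<and>
        (\<forall>t. t \<in> tm M \<Gamma> A \<longrightarrow> up M t \<in> tm M \<Gamma> (Lift M A) \<and> down M A (up M t) = t) \<and>
        (\<forall>t. t \<in> tm M \<Gamma> (Lift M A) \<longrightarrow> down M A t \<in> tm M \<Gamma> A \<and> up M (down M A t) = t) \<and>
        (\<forall>\<Delta> \<sigma>. \<sigma> \<in> sub M \<Delta> \<Gamma> \<longrightarrow>
           tsub M (Lift M A) \<sigma> = Lift M (tsub M A \<sigma>) \<and>
           (\<forall>t. t \<in> tm M \<Gamma> A \<longrightarrow> msub M (up M t) \<sigma> = up M (msub M t \<sigma>))))"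

definition dtt_model :: "('c, 's, 't, 'm, 'z) dtt_struct_scheme \<Rightarrow> bool" where
  "dtt_model M \<longleftrightarrow> cwf_base M \<and> cwf_ctx M \<and> cwf_pi M \<and> cwf_univ M \<and> cwf_lift M"

definition nontrivial_model :: "('c, 's, 't, 'm, 'z) dtt_struct_scheme \<Rightarrow> bool" where
  "nontrivial_model M \<longleftrightarrow> (\<exists>l A. A \<in> ty M l (emp M) \<and> tm M (emp M) A = {})"

definition apply_tm :: "('c, 's, 't, 'm, 'z) dtt_struct_scheme \<Rightarrow> 'c \<Rightarrow> 't \<Rightarrow> 't \<Rightarrow> 'm \<Rightarrow> 'm \<Rightarrow> 'm" where
  "apply_tm M \<Gamma> A B f u = msub M (app M A B f) (pair M (sid M \<Gamma>) u)"

definition universe_functions_constant :: "('c, 's, 't, 'm, 'z) dtt_struct_scheme \<Rightarrow> bool" where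
  "universe_functions_constant M \<longleftrightarrow>
    (\<forall>l \<Gamma> a f X Y.
       \<Gamma> \<in> con M \<and> a \<in> tm M \<Gamma> (Univ M \<Gamma> l) \<and>
       f \<in> tm M \<Gamma> (Pi M (Univ M \<Gamma> l) (tsub M (El M a) (wk M \<Gamma> (Univ M \<Gamma> l)))) \<and>
       X \<in> tm M \<Gamma> (Univ M \<Gamma> l) \<and> Y \<in> tm M \<Gamma> (Univ M \<Gamma> l) \<longrightarrow>
       apply_tm M \<Gamma> (Univ M \<Gamma> l) (tsub M (El M a) (wk M \<Gamma> (Univ M \<Gamma> l))) f X =
       apply_tm M \<Gamma> (Univ M \<Gamma> l) (tsub M (El M a) (wk M \<Gamma> (Univ M \<Gamma> l))) f Y)"

end

theory Submission
  imports Defs "HOL-Library.Countable_Set"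
begin

text \<open>
  The model consists of partial equivalence relations over Scott's graph model, whose tokens
  carry levels.  Application respects levels: the tokens of level at most \<open>l\<close> in \<open>f \<cdot> x\<close> are
  determined by those in \<open>f\<close> and \<open>x\<close>.  A type in \<open>U\<^sub>l\<close> is a PER that sees only the tokens of
  level at most \<open>l\<close>, whereas a code in \<open>U\<^sub>l\<close> keeps all its information in tokens of level \<open>l + 1\<close>.
  So all codes can be replaced by codes that look the same up to level \<open>l\<close>, and \<open>f : U\<^sub>l \<rightarrow> A\<close>
  cannot distinguish them if \<open>A : U\<^sub>l\<close>.  Contexts are PERs; types, terms and substitutions are
  graphs of realized functions, saturated under the PERs, so that the equational laws hold
  strictly.  The model has the size of the continuum, and a countable submodel is extracted.
\<close>

text \<open>Two demands on levels pull against each other: a code in \<open>U_l\<close> must show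
  nothing up to level \<open>l\<close>, yet the universe \<open>U_l\<close>, itself a type of level
  \<open>l + 1\<close>, must tell its codes apart. Reading a code at level exactly
  \<open>l + 1\<close> meets both. Dependent products must not spoil this: the family in a product
  code is applied to arguments of any level and still has to deliver its result at level
  \<open>l + 1\<close>. Hence \<open>Arr a t\<close> takes the level of \<open>t\<close> alone, and
  the tokens in \<open>a\<close> are restrained only by the guard in the application.
  \<open>Up\<close> is the one constructor that raises the level; it moves a code of level
  \<open>l\<close> to where codes of level \<open>l + 1\<close> are read.\<close>

datatype tok = PiTag nat | UTag nat | Lt tok | Rt tok | Up tok | Arr "tok list" tok

primrec lev :: "tok \<Rightarrow> nat" where
  "lev (PiTag n) = n"
| "lev (UTag n) = n"
| "lev (Lt t) = lev t"
| "lev (Rt t) = lev t"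
| "lev (Up t) = Suc (lev t)"
| "lev (Arr a t) = lev t"

section \<open>Realizers: continuous functions that respect levels\<close>

type_synonym rlz = "tok set"
type_synonym per = "(rlz \<times> rlz) set"

text \<open>The realizable functions: continuous, and such that the part of \<open>F x\<close> of level at most
  \<open>n\<close> depends only on the part of \<open>x\<close> of level at most \<open>n\<close>.\<close>

definition good :: "(rlz \<Rightarrow> rlz) \<Rightarrow> bool" where
  "good F \<longleftrightarrow> mono F \<and>
    (\<forall>x. \<forall>t\<in>F x. \<exists>a. finite a \<and> a \<subseteq> x \<and> (\<forall>s\<in>a. lev s \<le> lev t) \<and> t \<in> F a)"

text \<open>Application in the graph model with a guard on levels. The guard sits here and not in
  the elements, because PERs relate arbitrary sets of tokens and all of these must act in a
  level-respecting way.\<close>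

definition apl :: "rlz \<Rightarrow> rlz \<Rightarrow> rlz" (infixl "\<cdot>" 75) where
  "f \<cdot> x = {t. \<exists>a. Arr a t \<in> f \<and> set a \<subseteq> x \<and> (\<forall>s\<in>set a. lev s \<le> lev t)}"

definition abstr :: "(rlz \<Rightarrow> rlz) \<Rightarrow> rlz" where
  "abstr F = {u. \<exists>a t. u = Arr a t \<and> t \<in> F (set a)}"

definition pr :: "rlz \<Rightarrow> rlz \<Rightarrow> rlz" where
  "pr x y = Lt ` x \<union> Rt ` y"

definition prl :: "rlz \<Rightarrow> rlz" where
  "prl z = {t. Lt t \<in> z}"

definition prr :: "rlz \<Rightarrow> rlz" where
  "prr z = {t. Rt t \<in> z}"

lemma prl_pr [simp]: "prl (pr x y) = x" and prr_pr [simp]: "prr (pr x y) = y"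
  by (auto simp: prl_def prr_def pr_def)

lemma goodI:
  assumes "\<And>x y. x \<subseteq> y \<Longrightarrow> F x \<subseteq> F y"
    and "\<And>x t. t \<in> F x \<Longrightarrow> \<exists>a. finite a \<and> a \<subseteq> x \<and> (\<forall>s\<in>a. lev s \<le> lev t) \<and> t \<in> F a"
  shows "good F"
  using assms by (simp add: good_def mono_def)

lemma goodD:
  assumes "good F" "t \<in> F x"
  obtains a where "finite a" "a \<subseteq> x" "\<forall>s\<in>a. lev s \<le> lev t" "t \<in> F a"
  using assms unfolding good_def by blast

lemma good_mono: "good F \<Longrightarrow> x \<subseteq> y \<Longrightarrow> F x \<subseteq> F y"
  by (simp add: good_def mono_def)

lemma good_finite:
  assumes "good F" "finite b" "b \<subseteq> F x" "\<forall>s\<in>b. lev s \<le> n"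
  shows "\<exists>a. finite a \<and> a \<subseteq> x \<and> (\<forall>s\<in>a. lev s \<le> n) \<and> b \<subseteq> F a"
  using assms(2-4)
proof (induction b rule: finite_induct)
  case empty
  show ?case by (rule exI[of _ "{}"]) simp
next
  case (insert t b)
  then obtain a where a: "finite a" "a \<subseteq> x" "\<forall>s\<in>a. lev s \<le> n" "b \<subseteq> F a" by auto
  from insert.prems have "t \<in> F x" by simp
  then obtain a' where a': "finite a'" "a' \<subseteq> x" "\<forall>s\<in>a'. lev s \<le> lev t" "t \<in> F a'"
    by (rule goodD[OF assms(1)])
  have "F a \<subseteq> F (a \<union> a')" "F a' \<subseteq> F (a \<union> a')"
    by (simp_all add: good_mono[OF assms(1)])
  moreover have "\<forall>s\<in>a'. lev s \<le> n" using a'(3) insert.prems by fastforce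
  ultimately show ?case
    using a a' by (intro exI[of _ "a \<union> a'"]) blast
qed

lemma good_id: "good (\<lambda>x. x)"
proof (rule goodI)
  fix x :: rlz and t assume "t \<in> x"
  then show "\<exists>a. finite a \<and> a \<subseteq> x \<and> (\<forall>s\<in>a. lev s \<le> lev t) \<and> t \<in> a"
    by (intro exI[of _ "{t}"]) simp
qed

lemma good_const: "good (\<lambda>x. c)"
  by (rule goodI) auto

lemma good_comp:
  assumes "good F" "good G"
  shows "good (\<lambda>x. F (G x))"
proof (rule goodI)
  show "F (G x) \<subseteq> F (G y)" if "x \<subseteq> y" for x y
    using that assms by (simp add: good_mono)
  fix x t assume "t \<in> F (G x)"
  then obtain b where b: "finite b" "b \<subseteq> G x" "\<forall>s\<in>b. lev s \<le> lev t" "t \<in> F b"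
    by (rule goodD[OF assms(1)])
  from good_finite[OF assms(2) b(1-3)]
  obtain a where a: "finite a" "a \<subseteq> x" "\<forall>s\<in>a. lev s \<le> lev t" "b \<subseteq> G a" by blast
  moreover have "t \<in> F (G a)" using b(4) good_mono[OF assms(1) a(4)] by (rule rev_subsetD)
  ultimately show "\<exists>a. finite a \<and> a \<subseteq> x \<and> (\<forall>s\<in>a. lev s \<le> lev t) \<and> t \<in> F (G a)"
    by (intro exI[of _ a]) simp
qed

lemma good_preimage:
  assumes "\<And>t. lev (k t) = lev t"
  shows "good (\<lambda>z. {t. k t \<in> z})"
proof (rule goodI)
  fix x t assume "t \<in> {t. k t \<in> x}"
  then show "\<exists>a. finite a \<and> a \<subseteq> x \<and> (\<forall>s\<in>a. lev s \<le> lev t) \<and> t \<in> {t. k t \<in> a}"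
    by (intro exI[of _ "{k t}"]) (simp add: assms)
qed auto

lemma good_image:
  assumes "\<And>t. lev t \<le> lev (k t)"
  shows "good (\<lambda>x. k ` x)"
proof (rule goodI)
  fix x t assume "t \<in> k ` x"
  then obtain s where "s \<in> x" "t = k s" by blast
  then show "\<exists>a. finite a \<and> a \<subseteq> x \<and> (\<forall>s\<in>a. lev s \<le> lev t) \<and> t \<in> k ` a"
    by (intro exI[of _ "{s}"]) (simp add: assms)
qed auto

lemma good_Un:
  assumes "good F" "good G"
  shows "good (\<lambda>x. F x \<union> G x)"
proof (rule goodI)
  show "F x \<union> G x \<subseteq> F y \<union> G y" if "x \<subseteq> y" for x y
    using that assms by (meson Un_mono good_mono)
  fix x t assume "t \<in> F x \<union> G x"
  then obtain a where "finite a" "a \<subseteq> x" "\<forall>s\<in>a. lev s \<le> lev t" "t \<in> F a \<or> t \<in> G a"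
    by (elim UnE) (erule goodD[OF assms(1)] goodD[OF assms(2)], simp)+
  then show "\<exists>a. finite a \<and> a \<subseteq> x \<and> (\<forall>s\<in>a. lev s \<le> lev t) \<and> t \<in> F a \<union> G a"
    by (intro exI[of _ a]) simp
qed

lemma good_prl: "good F \<Longrightarrow> good (\<lambda>x. prl (F x))"
  using good_comp[OF good_preimage[of Lt]] by (simp add: prl_def)

lemma good_prr: "good F \<Longrightarrow> good (\<lambda>x. prr (F x))"
  using good_comp[OF good_preimage[of Rt]] by (simp add: prr_def)

lemma good_pr: "good F \<Longrightarrow> good G \<Longrightarrow> good (\<lambda>x. pr (F x) (G x))"
  unfolding pr_def
  by (intro good_Un good_comp[OF good_image[of Lt]] good_comp[OF good_image[of Rt]]) auto

lemma good_apl: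
  assumes "good F" "good G"
  shows "good (\<lambda>x. F x \<cdot> G x)"
proof (rule goodI)
  show "F x \<cdot> G x \<subseteq> F y \<cdot> G y" if "x \<subseteq> y" for x y
    using good_mono[OF assms(1) that] good_mono[OF assms(2) that]
    unfolding apl_def by blast
  fix x t assume "t \<in> F x \<cdot> G x"
  then obtain b where b: "Arr b t \<in> F x" "set b \<subseteq> G x" "\<forall>s\<in>set b. lev s \<le> lev t"
    by (auto simp: apl_def)
  \<comment> \<open>This bound is \<open>lev t\<close>, because \<open>Arr b t\<close> has the level
    of its result.\<close>
  obtain a where a: "finite a" "a \<subseteq> x" "\<forall>s\<in>a. lev s \<le> lev (Arr b t)" "Arr b t \<in> F a"
    using goodD[OF assms(1) b(1)] by blast
  obtain a' where a': "finite a'" "a' \<subseteq> x" "\<forall>s\<in>a'. lev s \<le> lev t" "set b \<subseteq> G a'"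
    using good_finite[OF assms(2) _ b(2,3)] by blast
  have "F a \<subseteq> F (a \<union> a')" "G a' \<subseteq> G (a \<union> a')"
    by (simp_all add: good_mono assms)
  then have "t \<in> F (a \<union> a') \<cdot> G (a \<union> a')"
    using a(4) a'(4) b(3) unfolding apl_def by blast
  then show "\<exists>a. finite a \<and> a \<subseteq> x \<and> (\<forall>s\<in>a. lev s \<le> lev t) \<and> t \<in> F a \<cdot> G a"
    using a(1-3) a'(1-3) by (intro exI[of _ "a \<union> a'"]) auto
qed

lemma good_abstr:
  assumes "good G"
  shows "good (\<lambda>g. abstr (\<lambda>x. G (pr g x)))"
proof (rule goodI)
  show "abstr (\<lambda>z. G (pr x z)) \<subseteq> abstr (\<lambda>z. G (pr y z))" if "x \<subseteq> y" for x y
  proof -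
    have "G (pr x z) \<subseteq> G (pr y z)" for z
      by (rule good_mono[OF assms]) (use that in \<open>auto simp: pr_def\<close>)
    then show ?thesis unfolding abstr_def by fast
  qed
  fix g u assume "u \<in> abstr (\<lambda>x. G (pr g x))"
  then obtain b t where u: "u = Arr b t" "t \<in> G (pr g (set b))" by (auto simp: abstr_def)
  obtain c where c: "finite c" "c \<subseteq> pr g (set b)" "\<forall>s\<in>c. lev s \<le> lev t" "t \<in> G c"
    using goodD[OF assms u(2)] by blast
  \<comment> \<open>Only the left half of \<open>c\<close> has to be finite and of low level; the
    right half is enlarged to all of \<open>set b\<close>, whose tokens may have any level.\<close>
  have "c \<subseteq> pr (prl c) (set b)" using c(2) by (fastforce simp: pr_def prl_def)
  then have "t \<in> G (pr (prl c) (set b))" by (rule subsetD[OF good_mono[OF assms], OF _ c(4)])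
  moreover have "finite (prl c)"
  proof (rule finite_imageD)
    show "finite (Lt ` prl c)" by (rule finite_subset[OF _ c(1)]) (auto simp: prl_def)
  qed (simp add: inj_on_def)
  moreover have "prl c \<subseteq> g" using c(2) by (auto simp: pr_def prl_def)
  moreover have "\<forall>s\<in>prl c. lev s \<le> lev t" using c(3) by (force simp: prl_def)
  ultimately show "\<exists>a. finite a \<and> a \<subseteq> g \<and> (\<forall>s\<in>a. lev s \<le> lev u) \<and> u \<in> abstr (\<lambda>x. G (pr a x))"
    by (intro exI[of _ "prl c"]) (auto simp: abstr_def u(1))
qed

lemma good_pr_right: "good G \<Longrightarrow> good (\<lambda>x. G (pr g x))"
  by (erule good_comp) (rule good_pr[OF good_const good_id])

text \<open>The finite approximations supplied by \<open>good\<close> satisfy the guard of the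
  application, so beta is an equality of sets. Eta is recovered only through the PERs.\<close>

lemma abstr_beta:
  assumes "good F"
  shows "abstr F \<cdot> x = F x"
proof
  show "abstr F \<cdot> x \<subseteq> F x"
    by (auto simp: abstr_def apl_def intro: subsetD[OF good_mono[OF assms]])
  show "F x \<subseteq> abstr F \<cdot> x"
  proof
    fix t assume "t \<in> F x"
    then obtain a where a: "finite a" "a \<subseteq> x" "\<forall>s\<in>a. lev s \<le> lev t" "t \<in> F a"
      by (rule goodD[OF assms])
    from a(1) obtain b where "set b = a" using finite_list by blast
    then show "t \<in> abstr F \<cdot> x" using a by (auto simp: abstr_def apl_def)
  qed
qed

section \<open>Codes of types and the PERs that they denote\<close>

definition agree :: "nat set \<Rightarrow> rlz \<Rightarrow> rlz \<Rightarrow> bool" where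
  "agree N x y \<longleftrightarrow> (\<forall>t. lev t \<in> N \<longrightarrow> (t \<in> x \<longleftrightarrow> t \<in> y))"

text \<open>Any set \<open>N\<close> of levels works, since \<open>Arr a t\<close> lies at the level
  of \<open>t\<close> whatever the levels in \<open>a\<close>.\<close>

lemma agree_apl_fun: "agree N f f' \<Longrightarrow> agree N (f \<cdot> x) (f' \<cdot> x)"
  by (auto simp: agree_def apl_def)

text \<open>Here the levels form an initial segment: a result at level \<open>n\<close> may depend
  on every token of the argument up to level \<open>n\<close>.\<close>

lemma agree_apl_arg: "agree {..l} x x' \<Longrightarrow> agree {..l} (f \<cdot> x) (f \<cdot> x')"
proof -
  have sub: "f \<cdot> x \<inter> {t. lev t \<le> l} \<subseteq> f \<cdot> x'" if "agree {..l} x x'" for x x'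
    using that unfolding agree_def apl_def by (force intro: order_trans)
  assume "agree {..l} x x'"
  moreover from this have "agree {..l} x' x" by (simp add: agree_def)
  ultimately show ?thesis using sub[of x x'] sub[of x' x] unfolding agree_def by blast
qed

definition PiPER :: "per \<Rightarrow> (rlz \<Rightarrow> per) \<Rightarrow> per" where
  "PiPER R S = {(f, f'). \<forall>x x'. (x, x') \<in> R \<longrightarrow> (f \<cdot> x, f' \<cdot> x') \<in> S x}"

definition unUp :: "rlz \<Rightarrow> rlz" where
  "unUp c = {t. Up t \<in> c}"

text \<open>\<open>Den l c R\<close>: the code \<open>c\<close> denotes the PER \<open>R\<close> of level \<open>l\<close>.  Only tokens of level
  \<open>Suc l\<close> of \<open>c\<close> are consulted.  With \<open>PiTag\<close>, \<open>c\<close> codes a product whose domain and family are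
  \<open>prl c\<close> and \<open>prr c\<close>.  Without it, \<open>c\<close> codes the empty type at level 0; at level \<open>Suc k\<close> it codes
  the universe \<open>k\<close> if it has \<open>UTag\<close>, and the lift of \<open>unUp c\<close> otherwise.\<close>

inductive DenS :: "nat \<Rightarrow> (rlz \<Rightarrow> per \<Rightarrow> bool) \<Rightarrow> rlz \<Rightarrow> per \<Rightarrow> bool" for n b where
  base: "PiTag n \<notin> c \<Longrightarrow> b c R \<Longrightarrow> DenS n b c R"
| pi: "PiTag n \<in> c \<Longrightarrow> DenS n b (prl c) R \<Longrightarrow>
       (\<And>x y. (x, y) \<in> R \<Longrightarrow> DenS n b (prr c \<cdot> x) (S x)) \<Longrightarrow>
       (\<And>x y. (x, y) \<in> R \<Longrightarrow> S x = S y) \<Longrightarrow> DenS n b c (PiPER R S)"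

primrec Den :: "nat \<Rightarrow> rlz \<Rightarrow> per \<Rightarrow> bool" where
  "Den 0 = DenS 1 (\<lambda>c R. R = {})"
| "Den (Suc l) = DenS (Suc (Suc l)) (\<lambda>c R.
     if UTag (Suc (Suc l)) \<in> c then R = {(c, c'). \<exists>Q. Den l c Q \<and> Den l c' Q}
     else Den l (unUp c) R)"

definition UPER :: "nat \<Rightarrow> per" where
  "UPER l = {(c, c'). \<exists>Q. Den l c Q \<and> Den l c' Q}"

text \<open>The starting point of the induction \<open>DenS\<close> at level \<open>l\<close>. The
  clause for universes is not monotone in the denotation relation, so levels are handled by
  recursion and only products by induction.\<close>

definition base_den :: "nat \<Rightarrow> rlz \<Rightarrow> per \<Rightarrow> bool" where
  "base_den l c R = (case l of 0 \<Rightarrow> R = {} | Suc k \<Rightarrow>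
     if UTag (Suc l) \<in> c then R = UPER k else Den k (unUp c) R)"

lemma Den_eq: "Den l = DenS (Suc l) (base_den l)"
  by (cases l) (simp_all add: base_den_def[abs_def] UPER_def)

lemma DenS_det:
  assumes "\<And>c R R'. b c R \<Longrightarrow> b c R' \<Longrightarrow> R = R'"
  shows "DenS n b c R \<Longrightarrow> DenS n b c R' \<Longrightarrow> R = R'"
proof (induction c R arbitrary: R' rule: DenS.induct)
  case (base c R)
  from base.prems base.hyps show ?case by cases (use assms in auto)
next
  case (pi c R S)
  from pi.prems pi.hyps(1) obtain R2 S2 where *: "R' = PiPER R2 S2" "DenS n b (prl c) R2"
    "\<And>x y. (x, y) \<in> R2 \<Longrightarrow> DenS n b (prr c \<cdot> x) (S2 x)" by cases auto
  with pi.IH have "R = R2" "\<And>x y. (x, y) \<in> R \<Longrightarrow> S x = S2 x" by blast+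
  then show ?case by (auto simp: * PiPER_def)
qed

lemma Den_det: "Den l c R \<Longrightarrow> Den l c R' \<Longrightarrow> R = R'"
proof (induction l arbitrary: c R R')
  case 0
  show ?case
    using 0 unfolding Den.simps by (rule DenS_det[rotated]) simp
next
  case (Suc l)
  show ?case
    using Suc.prems unfolding Den_eq
    by (rule DenS_det[rotated]) (simp add: base_den_def Suc.IH split: if_splits)
qed

definition is_per :: "per \<Rightarrow> bool" where
  "is_per R \<longleftrightarrow> sym R \<and> trans R"

lemma is_perD:
  assumes "is_per R"
  shows "(x, y) \<in> R \<Longrightarrow> (y, x) \<in> R" "(x, y) \<in> R \<Longrightarrow> (y, z) \<in> R \<Longrightarrow> (x, z) \<in> R"
    "(x, y) \<in> R \<Longrightarrow> (x, x) \<in> R" "(x, y) \<in> R \<Longrightarrow> (y, y) \<in> R"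
  using assms unfolding is_per_def by (meson symD transD)+

lemma is_perI:
  assumes "\<And>x y. (x, y) \<in> R \<Longrightarrow> (y, x) \<in> R"
    and "\<And>x y z. (x, y) \<in> R \<Longrightarrow> (y, z) \<in> R \<Longrightarrow> (x, z) \<in> R"
  shows "is_per R"
  using assms unfolding is_per_def by (meson symI transI)

text \<open>Transitivity rests on determinism: the code in the middle denotes only one PER.\<close>

lemma is_per_UPER: "is_per (UPER l)"
  by (rule is_perI) (use Den_det in \<open>unfold UPER_def, blast+\<close>)

lemma is_per_PiPER:
  assumes R: "is_per R" and S: "\<And>x y. (x, y) \<in> R \<Longrightarrow> is_per (S x)"
    and eq: "\<And>x y. (x, y) \<in> R \<Longrightarrow> S x = S y"
  shows "is_per (PiPER R S)"
proof (rule is_perI)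
  fix f g assume fg: "(f, g) \<in> PiPER R S"
  show "(g, f) \<in> PiPER R S"
    unfolding PiPER_def
  proof clarify
    fix x y assume xy: "(x, y) \<in> R"
    then have "(f \<cdot> y, g \<cdot> x) \<in> S y" using fg is_perD(1)[OF R] by (auto simp: PiPER_def)
    then show "(g \<cdot> x, f \<cdot> y) \<in> S x" using is_perD(1)[OF S[OF xy]] eq[OF xy] by simp
  qed
  fix h assume gh: "(g, h) \<in> PiPER R S"
  show "(f, h) \<in> PiPER R S"
    unfolding PiPER_def
  proof clarify
    fix x y assume xy: "(x, y) \<in> R"
    then have "(f \<cdot> x, g \<cdot> x) \<in> S x" using fg is_perD(3)[OF R] by (auto simp: PiPER_def)
    moreover have "(g \<cdot> x, h \<cdot> y) \<in> S x" using gh xy by (auto simp: PiPER_def)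
    ultimately show "(f \<cdot> x, h \<cdot> y) \<in> S x" using is_perD(2)[OF S[OF xy]] by blast
  qed
qed

lemma DenS_is_per:
  assumes "\<And>c R. b c R \<Longrightarrow> is_per R"
  shows "DenS n b c R \<Longrightarrow> is_per R"
  by (induction rule: DenS.induct) (use assms is_per_PiPER in blast)+

lemma Den_is_per: "Den l c R \<Longrightarrow> is_per R"
proof (induction l arbitrary: c R)
  case 0
  show ?case
    using 0 unfolding Den.simps by (rule DenS_is_per[rotated]) (simp add: is_per_def)
next
  case (Suc l)
  show ?case
    using Suc.prems unfolding Den_eq
    by (rule DenS_is_per[rotated]) (simp add: base_den_def is_per_UPER Suc.IH split: if_splits)
qed

text \<open>\<open>prl\<close>, \<open>prr\<close> and application to a fixed argument all preserve
  agreement at the single level \<open>n\<close>, so every subcode of a product is again read at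
  level \<open>n\<close>.\<close>

lemma DenS_agree:
  assumes "\<And>c c' R. agree {n} c c' \<Longrightarrow> b c R \<Longrightarrow> b c' R"
  shows "DenS n b c R \<Longrightarrow> agree {n} c c' \<Longrightarrow> DenS n b c' R"
proof (induction c R arbitrary: c' rule: DenS.induct)
  case (base c R)
  then show ?case using assms by (intro DenS.base) (auto simp: agree_def)
next
  case (pi c R S)
  have *: "agree {n} (prl c) (prl c')" "agree {n} (prr c \<cdot> x) (prr c' \<cdot> x)" for x
    using pi.prems by (auto simp: agree_def prl_def prr_def apl_def)
  show ?case
  proof (rule DenS.pi)
    show "PiTag n \<in> c'" using pi.hyps(1) pi.prems by (simp add: agree_def)
  qed (use pi.IH * pi.hyps(4) in blast)+
qed

lemma Den_agree: "Den l c R \<Longrightarrow> agree {Suc l} c c' \<Longrightarrow> Den l c' R"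
proof (induction l arbitrary: c R c')
  case 0
  show ?case
    using 0 unfolding Den.simps One_nat_def by (rule DenS_agree[rotated])
next
  case (Suc l)
  have "base_den (Suc l) c' R" if "agree {Suc (Suc l)} c c'" "base_den (Suc l) c R" for c c' R
  proof -
    \<comment> \<open>\<open>Up\<close> shifts by one: the tokens of \<open>unUp c\<close> at level
      \<open>Suc l\<close> come from tokens of \<open>c\<close> at level
      \<open>Suc (Suc l)\<close>.\<close>
    have "agree {Suc l} (unUp c) (unUp c')" using that(1) by (auto simp: agree_def unUp_def)
    then show ?thesis using that Suc.IH by (auto simp: base_den_def agree_def split: if_splits)
  qed
  then show ?case using Suc.prems unfolding Den_eq by (rule DenS_agree)
qed

definition lev_inv :: "nat \<Rightarrow> per \<Rightarrow> bool" where
  "lev_inv l R \<longleftrightarrow> (\<forall>x y y'. (x, y) \<in> R \<longrightarrow> agree {..l} y y' \<longrightarrow> (x, y') \<in> R)"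

text \<open>Functions that agree up to level \<open>l\<close> have values that do, so invariance
  passes from the fibres to the product.\<close>

lemma DenS_lev_inv:
  assumes "\<And>c R. b c R \<Longrightarrow> lev_inv l R"
  shows "DenS n b c R \<Longrightarrow> lev_inv l R"
proof (induction rule: DenS.induct)
  case (pi c R S)
  show ?case
    unfolding lev_inv_def PiPER_def
  proof clarify
    fix f g g' x x'
    assume *: "\<forall>x x'. (x, x') \<in> R \<longrightarrow> (f \<cdot> x, g \<cdot> x') \<in> S x" and "agree {..l} g g'" "(x, x') \<in> R"
    then have "agree {..l} (g \<cdot> x') (g' \<cdot> x')" by (simp add: agree_apl_fun)
    with * \<open>(x, x') \<in> R\<close> pi.IH(2) show "(f \<cdot> x, g' \<cdot> x') \<in> S x"
      unfolding lev_inv_def by blast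
  qed
qed (use assms in auto)

text \<open>Level \<open>Suc l\<close> just reaches the tokens at which codes in
  \<open>UPER l\<close> are read. At level \<open>l\<close> invariance fails, and this gap is what
  \<open>UPER_const\<close> exploits.\<close>

lemma lev_inv_UPER: "lev_inv (Suc l) (UPER l)"
proof -
  have "agree {..Suc l} c c' \<Longrightarrow> agree {Suc l} c c'" for c c' by (simp add: agree_def)
  then show ?thesis unfolding lev_inv_def UPER_def using Den_agree by blast
qed

lemma lev_inv_Suc: "lev_inv l R \<Longrightarrow> lev_inv (Suc l) R"
  by (auto simp: lev_inv_def agree_def)

lemma Den_lev_inv: "Den l c R \<Longrightarrow> lev_inv l R"
proof (induction l arbitrary: c R)
  case 0
  show ?case
    using 0 unfolding Den.simps by (rule DenS_lev_inv[rotated]) (simp add: lev_inv_def)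
next
  case (Suc l)
  show ?case
    using Suc.prems unfolding Den_eq
    by (rule DenS_lev_inv[rotated])
       (simp add: base_den_def lev_inv_UPER Suc.IH lev_inv_Suc split: if_splits)
qed

text \<open>Only the tokens of level \<open>Suc l\<close> of a code in \<open>UPER l\<close> matter, while a
  type of level \<open>l\<close> sees only the tokens of level at most \<open>l\<close> of a result.\<close>

lemma UPER_const:
  assumes A: "Den l d A" and f: "\<And>c c'. (c, c') \<in> UPER l \<Longrightarrow> (f \<cdot> c, f \<cdot> c') \<in> A"
    and X: "(X, X) \<in> UPER l" and Y: "(Y, Y) \<in> UPER l"
  shows "(f \<cdot> X, f \<cdot> Y) \<in> A"
proof -
  \<comment> \<open>Cutting a code down to level \<open>Suc l\<close> keeps all that
    \<open>Den\<close> reads and leaves no token up to level \<open>l\<close>, so all cut codes look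
    alike to a type of level \<open>l\<close>.\<close>
  let ?cut = "\<lambda>c. c \<inter> {t. lev t = Suc l}"
  have cut: "(c, ?cut c) \<in> UPER l" if "(c, c) \<in> UPER l" for c
  proof -
    have "agree {Suc l} c (?cut c)" by (simp add: agree_def)
    then show ?thesis using that Den_agree by (fastforce simp: UPER_def)
  qed
  have "agree {..l} (?cut X) (?cut Y)" by (auto simp: agree_def)
  then have "agree {..l} (f \<cdot> ?cut X) (f \<cdot> ?cut Y)" by (rule agree_apl_arg)
  then have "(f \<cdot> X, f \<cdot> ?cut Y) \<in> A"
    using f[OF cut[OF X]] Den_lev_inv[OF A] unfolding lev_inv_def by blast
  moreover have "(f \<cdot> ?cut Y, f \<cdot> Y) \<in> A"
    using f cut[OF Y] is_perD(1)[OF is_per_UPER] by blast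
  ultimately show ?thesis using is_perD(2)[OF Den_is_per[OF A]] by blast
qed

section \<open>Codes for the type formers\<close>

lemma Den_pi:
  assumes "Den l a R" "\<And>x y. (x, y) \<in> R \<Longrightarrow> Den l (b \<cdot> x) (S x)"
    "\<And>x y. (x, y) \<in> R \<Longrightarrow> S x = S y"
  shows "Den l ({PiTag (Suc l)} \<union> pr a b) (PiPER R S)"
proof -
  have "prl ({PiTag (Suc l)} \<union> pr a b) = a" "prr ({PiTag (Suc l)} \<union> pr a b) = b"
    by (auto simp: prl_def prr_def pr_def)
  then show ?thesis using assms unfolding Den_eq by (intro DenS.pi) auto
qed

lemma Den_UPER: "Den (Suc l) {UTag (Suc (Suc l))} (UPER l)"
  unfolding Den_eq by (rule DenS.base) (auto simp: base_den_def)

text \<open>A token \<open>Up t\<close> is neither a \<open>PiTag\<close> nor a \<open>UTag\<close>,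
  so a lifted code always reaches the last clause of the denotation, even when \<open>c\<close>
  codes a product or a universe.\<close>

lemma Den_lift: "Den l c R \<Longrightarrow> Den (Suc l) (Up ` c) R"
proof -
  have "unUp (Up ` c) = c" by (auto simp: unUp_def)
  then show "Den l c R \<Longrightarrow> ?thesis"
    by (subst Den_eq, intro DenS.base) (auto simp: base_den_def)
qed

text \<open>For products of mixed levels: a product code reads its domain and its family at the same
  level, so the lower one is lifted first.\<close>

lemma Den_lifts: "Den l c R \<Longrightarrow> Den (n + l) (((`) Up ^^ n) c) R"
  by (induction n) (simp_all add: Den_lift del: Den.simps)

lemma Den_empty: "Den 0 {} {}"
  by (simp add: DenS.base)

lemma good_lifts: "good F \<Longrightarrow> good (\<lambda>x. ((`) Up ^^ n) (F x))"
  by (induction n) (simp_all add: good_comp[OF good_image[of Up]])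

section \<open>Sections of families of PERs\<close>

text \<open>The saturated graphs of realizable sections of the family \<open>E\<close> of PERs over \<open>\<Gamma>\<close>.
  Substitutions are sections of a constant family, and types of level \<open>l\<close> those of \<open>UPER l\<close>.\<close>

definition sec :: "per \<Rightarrow> (rlz \<Rightarrow> per) \<Rightarrow> per \<Rightarrow> bool" where
  "sec \<Gamma> E r \<longleftrightarrow>
    (\<forall>g a. (g, a) \<in> r \<longrightarrow> (g, g) \<in> \<Gamma>) \<and>
    (\<forall>g a g' a'. (g, a) \<in> r \<longrightarrow> (g, g') \<in> \<Gamma> \<longrightarrow> (a, a') \<in> E g \<longrightarrow> (g', a') \<in> r) \<and>
    (\<forall>g a a'. (g, a) \<in> r \<longrightarrow> (g, a') \<in> r \<longrightarrow> (a, a') \<in> E g) \<and>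
    (\<exists>F. good F \<and> (\<forall>g. (g, g) \<in> \<Gamma> \<longrightarrow> (g, F g) \<in> r))"

lemma secI:
  assumes "\<And>g a. (g, a) \<in> r \<Longrightarrow> (g, g) \<in> \<Gamma>"
    and "\<And>g a g' a'. (g, a) \<in> r \<Longrightarrow> (g, g') \<in> \<Gamma> \<Longrightarrow> (a, a') \<in> E g \<Longrightarrow> (g', a') \<in> r"
    and "\<And>g a a'. (g, a) \<in> r \<Longrightarrow> (g, a') \<in> r \<Longrightarrow> (a, a') \<in> E g"
    and "good F" "\<And>g. (g, g) \<in> \<Gamma> \<Longrightarrow> (g, F g) \<in> r"
  shows "sec \<Gamma> E r"
  unfolding sec_def using assms(1-3) by (intro conjI exI[of _ F]) (blast intro: assms(4,5))+

lemma secD: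
  assumes "sec \<Gamma> E r"
  shows "(g, a) \<in> r \<Longrightarrow> (g, g) \<in> \<Gamma>"
    and "(g, a) \<in> r \<Longrightarrow> (g, g') \<in> \<Gamma> \<Longrightarrow> (a, a') \<in> E g \<Longrightarrow> (g', a') \<in> r"
    and "(g, a) \<in> r \<Longrightarrow> (g, a') \<in> r \<Longrightarrow> (a, a') \<in> E g"
  using assms unfolding sec_def by (elim conjE, blast)+

lemma sec_realizer:
  assumes "sec \<Gamma> E r"
  obtains F where "good F" "\<And>g. (g, g) \<in> \<Gamma> \<Longrightarrow> (g, F g) \<in> r"
  using assms unfolding sec_def by auto

lemma sec_ex: "sec \<Gamma> E r \<Longrightarrow> (g, g) \<in> \<Gamma> \<Longrightarrow> \<exists>a. (g, a) \<in> r"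
  by (erule sec_realizer) blast

lemma sec_move: "sec \<Gamma> E r \<Longrightarrow> (g, a) \<in> r \<Longrightarrow> (g, g') \<in> \<Gamma> \<Longrightarrow> (g', a) \<in> r"
  using secD(2,3) by blast

text \<open>Graphs of total functions, so one inclusion gives equality.\<close>

lemma sec_eqI:
  assumes r: "sec \<Gamma> E r" and r': "sec \<Gamma> E r'" and "r \<subseteq> r'"
  shows "r = r'"
proof
  show "r' \<subseteq> r"
  proof (clarify)
    fix g a assume a: "(g, a) \<in> r'"
    then have g: "(g, g) \<in> \<Gamma>" by (rule secD(1)[OF r'])
    then obtain b where b: "(g, b) \<in> r" using sec_ex[OF r] by blast
    then have "(b, a) \<in> E g" using a assms(3) secD(3)[OF r'] by blast
    then show "(g, a) \<in> r" by (rule secD(2)[OF r b g])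
  qed
qed fact

lemma sec_cong:
  assumes "\<And>g. (g, g) \<in> \<Gamma> \<Longrightarrow> E g = E' g" "sec \<Gamma> E r"
  shows "sec \<Gamma> E' r"
proof (rule sec_realizer[OF assms(2)])
  fix F assume "good F" "\<And>g. (g, g) \<in> \<Gamma> \<Longrightarrow> (g, F g) \<in> r"
  then show ?thesis
    by (intro secI[of r \<Gamma> E' F]) (metis secD[OF assms(2)] assms(1))+
qed

definition fam :: "per \<Rightarrow> (rlz \<Rightarrow> per) \<Rightarrow> bool" where
  "fam \<Gamma> E \<longleftrightarrow> is_per \<Gamma> \<and> (\<forall>g g'. (g, g') \<in> \<Gamma> \<longrightarrow> is_per (E g) \<and> E g = E g')"

lemma famD:
  assumes "fam \<Gamma> E"
  shows "is_per \<Gamma>" "(g, g') \<in> \<Gamma> \<Longrightarrow> is_per (E g)" "(g, g') \<in> \<Gamma> \<Longrightarrow> E g' = E g"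
  using assms unfolding fam_def by blast+

text \<open>A union, although by \<open>Den_ElP\<close> a type offers just one denotation at each
  \<open>g\<close>: this avoids choosing a code and gives the empty PER outside the context, as
  \<open>ElP_dom\<close> exploits.\<close>

definition ElP :: "nat \<Rightarrow> per \<Rightarrow> rlz \<Rightarrow> per" where
  "ElP l A g = {(x, y). \<exists>c R. (g, c) \<in> A \<and> Den l c R \<and> (x, y) \<in> R}"

lemma Den_ElP:
  assumes A: "sec \<Gamma> (\<lambda>_. UPER l) A" and c: "(g, c) \<in> A"
  shows "Den l c (ElP l A g)"
proof -
  have "(c, c) \<in> UPER l" using secD(3)[OF A c c] .
  then obtain R where R: "Den l c R" by (auto simp: UPER_def)
  have "ElP l A g = R"
  proof -
    have "R' = R" if "(g, c') \<in> A" "Den l c' R'" for c' R'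
      using secD(3)[OF A c that(1)] R that(2) Den_det unfolding UPER_def by blast
    then show ?thesis using R c unfolding ElP_def by blast
  qed
  then show ?thesis using R by simp
qed

lemma ElP_eqI:
  assumes "sec \<Gamma> (\<lambda>_. UPER l) A" "(g, c) \<in> A" "Den l c R"
  shows "ElP l A g = R"
  using Den_det Den_ElP assms by blast

lemma ElP_dom: "sec \<Gamma> (\<lambda>_. UPER l) A \<Longrightarrow> (x, y) \<in> ElP l A g \<Longrightarrow> (g, g) \<in> \<Gamma>"
  unfolding ElP_def using secD(1) by blast

lemma fam_ElP:
  assumes "is_per \<Gamma>" and A: "sec \<Gamma> (\<lambda>_. UPER l) A"
  shows "fam \<Gamma> (ElP l A)"
  unfolding fam_def
proof (intro conjI allI impI)
  fix g g' assume g: "(g, g') \<in> \<Gamma>"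
  then obtain c where c: "(g, c) \<in> A" using sec_ex[OF A] is_perD(3)[OF assms(1)] by blast
  show "is_per (ElP l A g)" using Den_ElP[OF A c] by (rule Den_is_per)
  show "ElP l A g = ElP l A g'"
    using Den_ElP[OF A c] Den_ElP[OF A sec_move[OF A c g]] by (rule Den_det)
qed fact

lemma sec_comp:
  assumes \<sigma>: "sec \<Delta> (\<lambda>_. \<Gamma>) \<sigma>" and r: "sec \<Gamma> E r" and E: "\<And>d g. (d, g) \<in> \<sigma> \<Longrightarrow> E' d = E g"
  shows "sec \<Delta> E' (\<sigma> O r)"
proof -
  obtain F where F: "good F" "\<And>g. (g, g) \<in> \<Delta> \<Longrightarrow> (g, F g) \<in> \<sigma>" by (rule sec_realizer[OF \<sigma>]) blast
  obtain G where G: "good G" "\<And>g. (g, g) \<in> \<Gamma> \<Longrightarrow> (g, G g) \<in> r" by (rule sec_realizer[OF r]) blast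
  show ?thesis
  proof (rule secI)
    show "good (\<lambda>x. G (F x))" using G(1) F(1) by (rule good_comp)
    show "(d, G (F d)) \<in> \<sigma> O r" if "(d, d) \<in> \<Delta>" for d
      using F(2)[OF that] G(2) secD(3)[OF \<sigma>] by blast
    show "(d, d) \<in> \<Delta>" if "(d, a) \<in> \<sigma> O r" for d a using that secD(1)[OF \<sigma>] by blast
    fix d a a'
    show "(d', a') \<in> \<sigma> O r" if da: "(d, a) \<in> \<sigma> O r" and d': "(d, d') \<in> \<Delta>" and a': "(a, a') \<in> E' d" for d'
    proof -
      from da obtain g where g: "(d, g) \<in> \<sigma>" "(g, a) \<in> r" by blast
      have "(d', g) \<in> \<sigma>" using sec_move[OF \<sigma> g(1) d'] .
      moreover have "(g, a') \<in> r"
        using secD(2)[OF r g(2) secD(1)[OF r g(2)]] a' E[OF g(1)] by simp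
      ultimately show ?thesis by blast
    qed
    show "(a, a') \<in> E' d" if da: "(d, a) \<in> \<sigma> O r" "(d, a') \<in> \<sigma> O r"
    proof -
      from da obtain g g' where g: "(d, g) \<in> \<sigma>" "(g, a) \<in> r" "(d, g') \<in> \<sigma>" "(g', a') \<in> r" by blast
      have "(g', a) \<in> r" using sec_move[OF r g(2) secD(3)[OF \<sigma> g(1,3)]] .
      then show ?thesis using secD(3)[OF r _ g(4)] E[OF g(3)] by simp
    qed
  qed
qed

lemma ElP_comp:
  assumes \<sigma>: "sec \<Delta> (\<lambda>_. \<Gamma>) \<sigma>" and A: "sec \<Gamma> (\<lambda>_. UPER l) A" and dg: "(d, g) \<in> \<sigma>"
  shows "ElP l (\<sigma> O A) d = ElP l A g"
proof -
  obtain c where c: "(g, c) \<in> A" using sec_ex[OF A] secD(3)[OF \<sigma> dg dg] by blast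
  have "sec \<Delta> (\<lambda>_. UPER l) (\<sigma> O A)" by (rule sec_comp[OF \<sigma> A]) simp
  then show ?thesis by (rule ElP_eqI) (use c dg Den_ElP[OF A c] in auto)
qed

text \<open>Saturating the graph of the identity function yields the PER itself. It serves as the
  identity substitution, and the unit laws below are equalities.\<close>

lemma sec_id: "is_per \<Gamma> \<Longrightarrow> sec \<Gamma> (\<lambda>_. \<Gamma>) \<Gamma>"
  by (rule secI[OF _ _ _ good_id]) (blast dest: is_perD)+

lemma sec_id_comp: "sec \<Gamma> E r \<Longrightarrow> is_per \<Gamma> \<Longrightarrow> \<Gamma> O r = r"
  unfolding relcomp_unfold using is_perD(1) secD(1) sec_move by fast

lemma sec_comp_id: "sec \<Delta> (\<lambda>_. \<Gamma>) \<sigma> \<Longrightarrow> \<sigma> O \<Gamma> = \<sigma>"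
  using secD by fast

section \<open>Context extension\<close>

definition extR :: "per \<Rightarrow> (rlz \<Rightarrow> per) \<Rightarrow> per" where
  "extR \<Gamma> E = {(z, z'). (prl z, prl z') \<in> \<Gamma> \<and> (prr z, prr z') \<in> E (prl z)}"

definition wkR :: "per \<Rightarrow> (rlz \<Rightarrow> per) \<Rightarrow> per" where
  "wkR \<Gamma> E = {(z, g). (z, z) \<in> extR \<Gamma> E \<and> (prl z, g) \<in> \<Gamma>}"

definition vzR :: "per \<Rightarrow> (rlz \<Rightarrow> per) \<Rightarrow> per" where
  "vzR \<Gamma> E = {(z, a). (z, z) \<in> extR \<Gamma> E \<and> (prr z, a) \<in> E (prl z)}"

definition pairR :: "per \<Rightarrow> per \<Rightarrow> per" where
  "pairR \<sigma> t = {(d, z). (d, prl z) \<in> \<sigma> \<and> (d, prr z) \<in> t}"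

lemma is_per_extR:
  assumes "fam \<Gamma> E"
  shows "is_per (extR \<Gamma> E)"
proof (rule is_perI)
  fix x y assume xy: "(x, y) \<in> extR \<Gamma> E"
  then have *: "(prl x, prl y) \<in> \<Gamma>" "(prr x, prr y) \<in> E (prl x)" by (auto simp: extR_def)
  note E = famD(2,3)[OF assms *(1)]
  show "(y, x) \<in> extR \<Gamma> E"
    using * is_perD(1)[OF famD(1)[OF assms]] is_perD(1)[OF E(1)] E(2) by (simp add: extR_def)
  fix z assume "(y, z) \<in> extR \<Gamma> E"
  then have **: "(prl y, prl z) \<in> \<Gamma>" "(prr y, prr z) \<in> E (prl x)" using E(2) by (auto simp: extR_def)
  show "(x, z) \<in> extR \<Gamma> E"
    using is_perD(2)[OF famD(1)[OF assms] *(1) **(1)] is_perD(2)[OF E(1) *(2) **(2)]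
    by (simp add: extR_def)
qed

lemma sec_wkR:
  assumes "fam \<Gamma> E"
  shows "sec (extR \<Gamma> E) (\<lambda>_. \<Gamma>) (wkR \<Gamma> E)"
proof (rule secI[OF _ _ _ good_prl[OF good_id]])
  note P = is_perD[OF famD(1)[OF assms]] and Q = is_perD[OF is_per_extR[OF assms]]
  fix z g z' g'
  assume "(z, g) \<in> wkR \<Gamma> E" and zz: "(z, z') \<in> extR \<Gamma> E" and g: "(g, g') \<in> \<Gamma>"
  then have "(prl z, g') \<in> \<Gamma>" "(prl z, prl z') \<in> \<Gamma>" using P(2) by (auto simp: wkR_def extR_def)
  then have "(prl z', g') \<in> \<Gamma>" using P(1,2) by blast
  then show "(z', g') \<in> wkR \<Gamma> E" using Q(4)[OF zz] by (simp add: wkR_def)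
next
  fix z g g' assume "(z, g) \<in> wkR \<Gamma> E" "(z, g') \<in> wkR \<Gamma> E"
  then show "(g, g') \<in> \<Gamma>"
    using is_perD(1,2)[OF famD(1)[OF assms]] unfolding wkR_def by blast
qed (auto simp: wkR_def extR_def)

lemma sec_vzR:
  assumes "fam \<Gamma> E"
  shows "sec (extR \<Gamma> E) (\<lambda>z. E (prl z)) (vzR \<Gamma> E)"
proof (rule secI[OF _ _ _ good_prr[OF good_id]])
  note Q = is_perD[OF is_per_extR[OF assms]]
  fix z a z' a'
  assume *: "(z, a) \<in> vzR \<Gamma> E" "(z, z') \<in> extR \<Gamma> E" "(a, a') \<in> E (prl z)"
  then have z: "(prl z, prl z') \<in> \<Gamma>" "(prr z, prr z') \<in> E (prl z)" by (auto simp: extR_def)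
  note E = famD(2,3)[OF assms z(1)]
  show "(z', a') \<in> vzR \<Gamma> E"
    using *(1,3) z(2) Q(4)[OF *(2)] is_perD(1,2)[OF E(1)] unfolding vzR_def E(2) mem_Collect_eq case_prod_conv E(2) by blast
next
  fix z a a' assume "(z, a) \<in> vzR \<Gamma> E" "(z, a') \<in> vzR \<Gamma> E"
  then show "(a, a') \<in> E (prl z)"
    using is_perD(1,2)[OF famD(2)[OF assms, of "prl z" "prl z"]]
    unfolding vzR_def extR_def by blast
qed (auto simp: vzR_def extR_def)

lemma sec_pairR:
  assumes \<sigma>: "sec \<Delta> (\<lambda>_. \<Gamma>) \<sigma>" and t: "sec \<Delta> E' t" and E: "\<And>d g. (d, g) \<in> \<sigma> \<Longrightarrow> E' d = E g"
  shows "sec \<Delta> (\<lambda>_. extR \<Gamma> E) (pairR \<sigma> t)"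
proof -
  obtain F where F: "good F" "\<And>g. (g, g) \<in> \<Delta> \<Longrightarrow> (g, F g) \<in> \<sigma>" by (rule sec_realizer[OF \<sigma>]) blast
  obtain G where G: "good G" "\<And>g. (g, g) \<in> \<Delta> \<Longrightarrow> (g, G g) \<in> t" by (rule sec_realizer[OF t]) blast
  show ?thesis
  proof (rule secI)
    show "good (\<lambda>x. pr (F x) (G x))" using F(1) G(1) by (rule good_pr)
    show "(d, pr (F d) (G d)) \<in> pairR \<sigma> t" if "(d, d) \<in> \<Delta>" for d
      using F(2) G(2) that by (simp add: pairR_def)
    fix d z z'
    show "(d, d) \<in> \<Delta>" if "(d, z) \<in> pairR \<sigma> t"
      using that secD(1)[OF \<sigma>] by (auto simp: pairR_def)
    show "(d', z') \<in> pairR \<sigma> t"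
      if z: "(d, z) \<in> pairR \<sigma> t" and d: "(d, d') \<in> \<Delta>" and e: "(z, z') \<in> extR \<Gamma> E" for d'
      using z d e E[of d "prl z"] secD(2)[OF \<sigma> _ d] secD(2)[OF t _ d]
      unfolding pairR_def extR_def by auto
    show "(z, z') \<in> extR \<Gamma> E" if "(d, z) \<in> pairR \<sigma> t" "(d, z') \<in> pairR \<sigma> t"
      using that E[of d "prl z"] secD(3)[OF \<sigma>] secD(3)[OF t]
      unfolding pairR_def extR_def by auto
  qed
qed

text \<open>Surjective pairing fails for sets of tokens but holds for saturated graphs, as
  \<open>extR\<close> looks at the two halves of \<open>z\<close> and nothing else.\<close>

lemma pairR_wkR_vzR: "pairR (wkR \<Gamma> E) (vzR \<Gamma> E) = extR \<Gamma> E" if "fam \<Gamma> E"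
  using is_perD(3)[OF is_per_extR[OF that]] unfolding pairR_def wkR_def vzR_def
  by (auto simp: extR_def)

lemma pairR_wkR:
  assumes \<sigma>: "sec \<Delta> (\<lambda>_. \<Gamma>) \<sigma>" and t: "sec \<Delta> E' t"
    and E: "\<And>d g. (d, g) \<in> \<sigma> \<Longrightarrow> E' d = E g"
  shows "pairR \<sigma> t O wkR \<Gamma> E = \<sigma>"
proof
  show "pairR \<sigma> t O wkR \<Gamma> E \<subseteq> \<sigma>"
    unfolding pairR_def wkR_def using secD(2)[OF \<sigma> _ secD(1)[OF \<sigma>]] by blast
  show "\<sigma> \<subseteq> pairR \<sigma> t O wkR \<Gamma> E"
  proof clarify
    fix d g assume dg: "(d, g) \<in> \<sigma>"
    then obtain a where a: "(d, a) \<in> t" using sec_ex[OF t] secD(1)[OF \<sigma>] by blast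
    have "(d, pr g a) \<in> pairR \<sigma> t" using a dg by (simp add: pairR_def)
    moreover have "(pr g a, g) \<in> wkR \<Gamma> E"
      using secD(3)[OF t a a] secD(3)[OF \<sigma> dg dg] E[OF dg] by (simp add: wkR_def extR_def)
    ultimately show "(d, g) \<in> pairR \<sigma> t O wkR \<Gamma> E" by blast
  qed
qed

lemma pairR_vzR:
  assumes \<sigma>: "sec \<Delta> (\<lambda>_. \<Gamma>) \<sigma>" and t: "sec \<Delta> E' t"
    and E: "\<And>d g. (d, g) \<in> \<sigma> \<Longrightarrow> E' d = E g"
  shows "pairR \<sigma> t O vzR \<Gamma> E = t"
proof
  show "pairR \<sigma> t O vzR \<Gamma> E \<subseteq> t"
  proof clarify
    fix d z a assume "(d, z) \<in> pairR \<sigma> t" "(z, a) \<in> vzR \<Gamma> E"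
    then show "(d, a) \<in> t"
      using E[of d "prl z"] secD(2)[OF t, of d "prr z" d a] secD(1)[OF t, of d "prr z"]
      by (auto simp: pairR_def vzR_def)
  qed
  show "t \<subseteq> pairR \<sigma> t O vzR \<Gamma> E"
  proof clarify
    fix d a assume a: "(d, a) \<in> t"
    then obtain g where dg: "(d, g) \<in> \<sigma>" using sec_ex[OF \<sigma>] secD(1)[OF t] by blast
    have "(d, pr g a) \<in> pairR \<sigma> t" using a dg by (simp add: pairR_def)
    moreover have "(pr g a, a) \<in> vzR \<Gamma> E"
      using secD(3)[OF t a a] secD(3)[OF \<sigma> dg dg] E[OF dg] by (simp add: vzR_def extR_def)
    ultimately show "(d, a) \<in> pairR \<sigma> t O vzR \<Gamma> E" by blast
  qed
qed

lemma comp_pairR: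
  assumes \<tau>: "sec \<Theta> (\<lambda>_. \<Delta>) \<tau>" and t: "sec \<Delta> E' t"
  shows "\<tau> O pairR \<sigma> t = pairR (\<tau> O \<sigma>) (\<tau> O t)"
proof
  show "pairR (\<tau> O \<sigma>) (\<tau> O t) \<subseteq> \<tau> O pairR \<sigma> t"
  proof clarify
    fix x z assume "(x, z) \<in> pairR (\<tau> O \<sigma>) (\<tau> O t)"
    then obtain d d' where d: "(x, d) \<in> \<tau>" "(d, prl z) \<in> \<sigma>" "(x, d') \<in> \<tau>" "(d', prr z) \<in> t"
      by (auto simp: pairR_def)
    have "(d, prr z) \<in> t" using sec_move[OF t d(4) secD(3)[OF \<tau> d(3,1)]] .
    then show "(x, z) \<in> \<tau> O pairR \<sigma> t" using d by (auto simp: pairR_def)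
  qed
qed (auto simp: pairR_def)

section \<open>Dependent products\<close>

lemma PiPER_cong:
  assumes "\<And>x x'. (x, x') \<in> R \<Longrightarrow> S x = S' x"
  shows "PiPER R S = PiPER R S'"
  using assms by (fastforce simp: PiPER_def)

definition PiFam :: "(rlz \<Rightarrow> per) \<Rightarrow> (rlz \<Rightarrow> per) \<Rightarrow> rlz \<Rightarrow> per" where
  "PiFam E G g = PiPER (E g) (\<lambda>x. G (pr g x))"

text \<open>Admitting all codes of the product PER makes the graph saturated and lets stability
  under substitution be checked on PERs alone. \<open>Domain A\<close> stands in for the context,
  which \<open>Pi\<close> does not receive as an argument.\<close>

definition PiR :: "nat \<Rightarrow> per \<Rightarrow> nat \<Rightarrow> per \<Rightarrow> per" where
  "PiR l A k B = {(g, c). g \<in> Domain A \<and> Den (max l k) c (PiFam (ElP l A) (ElP k B) g)}"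

text \<open>Testing \<open>f\<close> at related pairs \<open>(x, x')\<close>, not at single points,
  makes it respect equality of arguments, as the product PER demands.\<close>

definition lamR :: "nat \<Rightarrow> per \<Rightarrow> per \<Rightarrow> per" where
  "lamR l A t = {(g, f). g \<in> Domain A \<and> (\<forall>x x'. (x, x') \<in> ElP l A g \<longrightarrow> (pr g x, f \<cdot> x') \<in> t)}"

text \<open>The passage through \<open>ElP k B z\<close> saturates the values and confines
  \<open>z\<close> to the extended context.\<close>

definition appR :: "nat \<Rightarrow> per \<Rightarrow> per \<Rightarrow> per" where
  "appR k B f = {(z, b). \<exists>h. (prl z, h) \<in> f \<and> (h \<cdot> prr z, b) \<in> ElP k B z}"

lemma sec_Domain: "sec \<Gamma> E r \<Longrightarrow> g \<in> Domain r \<longleftrightarrow> (g, g) \<in> \<Gamma>"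
  using sec_ex secD(1) by fast

locale pi_data =
  fixes \<Gamma> :: per and l k :: nat and A B :: per
  assumes \<Gamma>: "is_per \<Gamma>"
    and A: "sec \<Gamma> (\<lambda>_. UPER l) A"
    and B: "sec (extR \<Gamma> (ElP l A)) (\<lambda>_. UPER k) B"
begin

abbreviation "E \<equiv> ElP l A"
abbreviation "G \<equiv> ElP k B"
abbreviation "\<Gamma>A \<equiv> extR \<Gamma> E"

lemma famE: "fam \<Gamma> E" using \<Gamma> A by (rule fam_ElP)

lemma famG: "fam \<Gamma>A G" using is_per_extR[OF famE] B by (rule fam_ElP)

lemma pr_ext: "(g, g') \<in> \<Gamma> \<Longrightarrow> (x, x') \<in> E g \<Longrightarrow> (pr g x, pr g' x') \<in> \<Gamma>A"
  by (simp add: extR_def)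

lemma PiFam_move:
  assumes g: "(g, g') \<in> \<Gamma>"
  shows "PiFam E G g' = PiFam E G g"
  unfolding PiFam_def famD(3)[OF famE g]
proof (rule PiPER_cong)
  fix x x' assume "(x, x') \<in> E g"
  then have "(x, x) \<in> E g" using is_perD(3)[OF famD(2)[OF famE g]] by blast
  then show "G (pr g' x) = G (pr g x)" using famD(3)[OF famG pr_ext[OF g]] by blast
qed

lemma sec_PiR: "sec \<Gamma> (\<lambda>_. UPER (max l k)) (PiR l A k B)"
proof -
  let ?m = "max l k"
  obtain F where F: "good F" "\<And>g. (g, g) \<in> \<Gamma> \<Longrightarrow> (g, F g) \<in> A" by (rule sec_realizer[OF A]) blast
  obtain H where H: "good H" "\<And>g. (g, g) \<in> \<Gamma>A \<Longrightarrow> (g, H g) \<in> B" by (rule sec_realizer[OF B]) blast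
  let ?F = "\<lambda>g. ((`) Up ^^ (?m - l)) (F g)" and ?H = "\<lambda>g. ((`) Up ^^ (?m - k)) (H g)"
  have gF: "good ?F" and gH: "good ?H" using F(1) H(1) by (simp_all add: good_lifts)
  show ?thesis
  proof (rule secI)
    show "good (\<lambda>g. {PiTag (Suc ?m)} \<union> pr (?F g) (abstr (\<lambda>x. ?H (pr g x))))"
      by (rule good_Un[OF good_const good_pr[OF gF good_abstr[OF gH]]])
    fix g c c'
    show "(g, {PiTag (Suc ?m)} \<union> pr (?F g) (abstr (\<lambda>x. ?H (pr g x)))) \<in> PiR l A k B"
      if g: "(g, g) \<in> \<Gamma>"
    proof -
      have "Den ?m ({PiTag (Suc ?m)} \<union> pr (?F g) (abstr (\<lambda>x. ?H (pr g x)))) (PiFam E G g)"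
        unfolding PiFam_def
      proof (rule Den_pi)
        show "Den ?m (?F g) (E g)"
          using Den_lifts[OF Den_ElP[OF A F(2)[OF g]], of "?m - l"] by simp
        fix x y assume xy: "(x, y) \<in> E g"
        then have "(x, x) \<in> E g" using is_perD(3)[OF famD(2)[OF famE g]] by blast
        then have "(pr g x, pr g x) \<in> \<Gamma>A" by (rule pr_ext[OF g])
        then have "Den ?m (?H (pr g x)) (G (pr g x))"
          using Den_lifts[OF Den_ElP[OF B H(2)], of _ "?m - k"] by simp
        then show "Den ?m (abstr (\<lambda>x. ?H (pr g x)) \<cdot> x) (G (pr g x))"
          by (subst abstr_beta[OF good_pr_right[OF gH]])
        show "G (pr g x) = G (pr g y)" using famD(3)[OF famG pr_ext[OF g xy]] by simp
      qed
      then show ?thesis using g sec_Domain[OF A] by (simp add: PiR_def)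
    qed
    show "(g, g) \<in> \<Gamma>" if "(g, c) \<in> PiR l A k B"
      using that sec_Domain[OF A] by (simp add: PiR_def)
    show "(g', c') \<in> PiR l A k B"
      if c: "(g, c) \<in> PiR l A k B" and g: "(g, g') \<in> \<Gamma>" and e: "(c, c') \<in> UPER ?m" for g'
    proof -
      have "Den ?m c (PiFam E G g)" using c by (simp add: PiR_def)
      then have "Den ?m c' (PiFam E G g)" using e Den_det unfolding UPER_def by blast
      then show ?thesis
        using PiFam_move[OF g] is_perD(4)[OF \<Gamma> g] sec_Domain[OF A] by (simp add: PiR_def)
    qed
    show "(c, c') \<in> UPER ?m" if "(g, c) \<in> PiR l A k B" "(g, c') \<in> PiR l A k B"
      using that by (auto simp: PiR_def UPER_def)
  qed
qed

lemma ElP_PiR: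
  assumes g: "(g, g) \<in> \<Gamma>"
  shows "ElP (max l k) (PiR l A k B) g = PiFam E G g"
proof -
  obtain c where "(g, c) \<in> PiR l A k B" using sec_ex[OF sec_PiR g] by blast
  then show ?thesis by (rule ElP_eqI[OF sec_PiR]) (use \<open>(g, c) \<in> PiR l A k B\<close> in \<open>simp add: PiR_def\<close>)
qed

lemma sec_PiFam: "sec \<Gamma> (ElP (max l k) (PiR l A k B)) f \<longleftrightarrow> sec \<Gamma> (PiFam E G) f"
  using sec_cong[of \<Gamma> "ElP (max l k) (PiR l A k B)" "PiFam E G"]
    sec_cong[of \<Gamma> "PiFam E G" "ElP (max l k) (PiR l A k B)"] ElP_PiR by auto

lemma sec_lamR:
  assumes t: "sec \<Gamma>A G t"
  shows "sec \<Gamma> (PiFam E G) (lamR l A t)"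
proof -
  obtain F where F: "good F" "\<And>g. (g, g) \<in> \<Gamma>A \<Longrightarrow> (g, F g) \<in> t" by (rule sec_realizer[OF t]) blast
  have D: "(g, f) \<in> lamR l A t \<longleftrightarrow>
      (g, g) \<in> \<Gamma> \<and> (\<forall>x x'. (x, x') \<in> E g \<longrightarrow> (pr g x, f \<cdot> x') \<in> t)" for g f
    by (simp add: lamR_def sec_Domain[OF A])
  show ?thesis
  proof (rule secI)
    show "good (\<lambda>g. abstr (\<lambda>x. F (pr g x)))" by (rule good_abstr[OF F(1)])
    fix g f f'
    show "(g, abstr (\<lambda>x. F (pr g x))) \<in> lamR l A t" if g: "(g, g) \<in> \<Gamma>"
      unfolding D abstr_beta[OF good_pr_right[OF F(1)]]
    proof (intro conjI allI impI)
      fix x x' assume "(x, x') \<in> E g"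
      then have "(pr g x', pr g x) \<in> \<Gamma>A"
        using pr_ext[OF g] is_perD(1)[OF famD(2)[OF famE g]] by blast
      then show "(pr g x, F (pr g x')) \<in> t"
        using sec_move[OF t F(2)] is_perD(3)[OF famD(1)[OF famG]] by blast
    qed fact
    show "(g, g) \<in> \<Gamma>" if "(g, f) \<in> lamR l A t" using that by (simp add: D)
    show "(g', f') \<in> lamR l A t"
      if f: "(g, f) \<in> lamR l A t" and g: "(g, g') \<in> \<Gamma>" and f': "(f, f') \<in> PiFam E G g" for g'
      unfolding D
    proof (intro conjI allI impI)
      show "(g', g') \<in> \<Gamma>" using is_perD(4)[OF \<Gamma> g] .
      fix x x' assume "(x, x') \<in> E g'"
      then have x: "(x, x') \<in> E g" and xx: "(x, x) \<in> E g"
        using famD(3)[OF famE g] is_perD(3)[OF famD(2)[OF famE g]] by auto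
      have "(pr g x, f \<cdot> x) \<in> t" using f xx by (simp add: D)
      moreover have "(f \<cdot> x, f' \<cdot> x') \<in> G (pr g x)" using f' x by (auto simp: PiFam_def PiPER_def)
      ultimately show "(pr g' x, f' \<cdot> x') \<in> t"
        using secD(2)[OF t] pr_ext[OF g xx] by blast
    qed
    show "(f, f') \<in> PiFam E G g" if "(g, f) \<in> lamR l A t" "(g, f') \<in> lamR l A t"
      unfolding PiFam_def PiPER_def
    proof clarify
      fix x x' assume x: "(x, x') \<in> E g"
      have "(g, g) \<in> \<Gamma>" using that by (simp add: D)
      from is_perD(3)[OF famD(2)[OF famE this] x] have "(pr g x, f \<cdot> x) \<in> t" "(pr g x, f' \<cdot> x') \<in> t"
        using that x by (simp_all add: D)
      then show "(f \<cdot> x, f' \<cdot> x') \<in> G (pr g x)" by (rule secD(3)[OF t])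
    qed
  qed
qed

lemma sec_appR:
  assumes f: "sec \<Gamma> (PiFam E G) f"
  shows "sec \<Gamma>A G (appR k B f)"
proof -
  obtain F where F: "good F" "\<And>g. (g, g) \<in> \<Gamma> \<Longrightarrow> (g, F g) \<in> f" by (rule sec_realizer[OF f]) blast
  \<comment> \<open>Independence of the chosen realizer: saturation and uniqueness of values below
    both reduce to it.\<close>
  have ap: "(h \<cdot> prr z, h' \<cdot> prr z') \<in> G z"
    if "(prl z, h) \<in> f" "(prl z', h') \<in> f" "(z, z') \<in> \<Gamma>A" for h h' z z'
  proof -
    have z: "(prl z, prl z') \<in> \<Gamma>" "(prr z, prr z') \<in> E (prl z)" using that(3) by (auto simp: extR_def)
    have "(prl z, h') \<in> f" using sec_move[OF f that(2) is_perD(1)[OF \<Gamma> z(1)]] .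
    with that(1) have "(h, h') \<in> PiFam E G (prl z)" by (rule secD(3)[OF f])
    then have "(h \<cdot> prr z, h' \<cdot> prr z') \<in> G (pr (prl z) (prr z))"
      using z(2) by (auto simp: PiFam_def PiPER_def)
    \<comment> \<open>\<open>z\<close> may hold tokens that are neither \<open>Lt\<close> nor
      \<open>Rt\<close>, so it is only related to the pair of its halves.\<close>
    moreover have "(z, pr (prl z) (prr z)) \<in> \<Gamma>A"
      using is_perD(3)[OF is_per_extR[OF famE] that(3)] by (simp add: extR_def)
    ultimately show ?thesis using famD(3)[OF famG] by blast
  qed
  show ?thesis
  proof (rule secI)
    show "good (\<lambda>z. F (prl z) \<cdot> prr z)"
      by (rule good_apl[OF good_comp[OF F(1) good_prl[OF good_id]] good_prr[OF good_id]])
    fix z b b'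
    show "(z, F (prl z) \<cdot> prr z) \<in> appR k B f" if "(z, z) \<in> \<Gamma>A"
    proof -
      have "(prl z, F (prl z)) \<in> f" by (rule F(2)) (use that in \<open>simp add: extR_def\<close>)
      then show ?thesis using ap[OF _ _ that] by (auto simp: appR_def)
    qed
    show "(z, z) \<in> \<Gamma>A" if "(z, b) \<in> appR k B f"
      using that ElP_dom[OF B] by (auto simp: appR_def)
    show "(z', b') \<in> appR k B f"
      if z: "(z, b) \<in> appR k B f" and zz: "(z, z') \<in> \<Gamma>A" and b: "(b, b') \<in> G z" for z'
    proof -
      from z obtain h where h: "(prl z, h) \<in> f" "(h \<cdot> prr z, b) \<in> G z" by (auto simp: appR_def)
      have "(prl z, prl z') \<in> \<Gamma>" using zz by (simp add: extR_def)
      then have h': "(prl z', h) \<in> f" by (rule sec_move[OF f h(1)])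
      note P = is_perD[OF famD(2)[OF famG zz]]
      have "(h \<cdot> prr z', b') \<in> G z"
        using P(2)[OF P(1)[OF ap[OF h(1) h' zz]] P(2)[OF h(2) b]] .
      then show ?thesis using h' famD(3)[OF famG zz] by (auto simp: appR_def)
    qed
    show "(b, b') \<in> G z" if z: "(z, b) \<in> appR k B f" "(z, b') \<in> appR k B f"
    proof -
      from z obtain h h' where h: "(prl z, h) \<in> f" "(h \<cdot> prr z, b) \<in> G z"
        "(prl z, h') \<in> f" "(h' \<cdot> prr z, b') \<in> G z" by (auto simp: appR_def)
      have zz: "(z, z) \<in> \<Gamma>A" using ElP_dom[OF B h(2)] .
      note P = is_perD[OF famD(2)[OF famG zz]]
      show ?thesis using P(2)[OF P(1)[OF h(2)] P(2)[OF ap[OF h(1,3) zz] h(4)]] .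
    qed
  qed
qed

lemma app_lam:
  assumes t: "sec \<Gamma>A G t"
  shows "appR k B (lamR l A t) = t"
proof (rule sec_eqI[OF sec_appR[OF sec_lamR[OF t]] t], clarify)
  fix z b assume "(z, b) \<in> appR k B (lamR l A t)"
  then obtain h where h: "(prl z, h) \<in> lamR l A t" "(h \<cdot> prr z, b) \<in> G z" by (auto simp: appR_def)
  have zz: "(z, z) \<in> \<Gamma>A" using ElP_dom[OF B h(2)] .
  then have "(pr (prl z) (prr z), h \<cdot> prr z) \<in> t" using h(1) by (auto simp: lamR_def extR_def)
  moreover have "(pr (prl z) (prr z), z) \<in> \<Gamma>A" using zz by (simp add: extR_def)
  ultimately have "(z, h \<cdot> prr z) \<in> t" by (rule sec_move[OF t])
  then show "(z, b) \<in> t" using h(2) zz by (blast intro: secD(2)[OF t])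
qed

text \<open>Eta: a realizer \<open>h\<close> in \<open>f\<close> need not have the form
  \<open>abstr F\<close>, but it tracks its own application, and \<open>lamR\<close> collects all
  realizers that do.\<close>

lemma lam_app:
  assumes f: "sec \<Gamma> (PiFam E G) f"
  shows "lamR l A (appR k B f) = f"
proof (rule sec_eqI[symmetric, OF f sec_lamR[OF sec_appR[OF f]]], clarify)
  fix g h assume h: "(g, h) \<in> f"
  have g: "(g, g) \<in> \<Gamma>" using secD(1)[OF f h] .
  moreover have "(pr g x, h \<cdot> x') \<in> appR k B f" if x: "(x, x') \<in> E g" for x x'
    using h secD(3)[OF f h h] x by (auto simp: appR_def PiFam_def PiPER_def)
  ultimately show "(g, h) \<in> lamR l A (appR k B f)"
    by (simp add: lamR_def sec_Domain[OF A])
qed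

context
  fixes \<Delta> \<sigma> :: per
  assumes \<Delta>: "is_per \<Delta>" and \<sigma>: "sec \<Delta> (\<lambda>_. \<Gamma>) \<sigma>"
begin

abbreviation "E' \<equiv> ElP l (\<sigma> O A)"
text \<open>This is what \<open>lift_sub\<close> computes to in the model, so that the stability
  lemmas match the axioms literally.\<close>

abbreviation "\<sigma>A \<equiv> pairR (wkR \<Delta> E' O \<sigma>) (vzR \<Delta> E')"

lemma A_sub: "sec \<Delta> (\<lambda>_. UPER l) (\<sigma> O A)"
  by (rule sec_comp[OF \<sigma> A]) simp

lemma E_sub: "(d, g) \<in> \<sigma> \<Longrightarrow> E' d = E g"
  by (rule ElP_comp[OF \<sigma> A])

lemma sec_lift_sub: "sec (extR \<Delta> E') (\<lambda>_. \<Gamma>A) \<sigma>A"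
proof (rule sec_pairR)
  have fam: "fam \<Delta> E'" by (rule fam_ElP[OF \<Delta> A_sub])
  show "sec (extR \<Delta> E') (\<lambda>_. \<Gamma>) (wkR \<Delta> E' O \<sigma>)" by (rule sec_comp[OF sec_wkR[OF fam] \<sigma>]) simp
  show "sec (extR \<Delta> E') (\<lambda>z. E' (prl z)) (vzR \<Delta> E')" by (rule sec_vzR[OF fam])
  show "E' (prl z) = E g" if "(z, g) \<in> wkR \<Delta> E' O \<sigma>" for z g
  proof -
    from that obtain d where d: "(prl z, d) \<in> \<Delta>" "(d, g) \<in> \<sigma>" by (auto simp: wkR_def)
    show ?thesis using famD(3)[OF fam d(1)] E_sub[OF d(2)] by simp
  qed
qed

lemma pi_data_sub: "pi_data \<Delta> l k (\<sigma> O A) (\<sigma>A O B)"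
proof
  show "sec (extR \<Delta> E') (\<lambda>_. UPER k) (\<sigma>A O B)" by (rule sec_comp[OF sec_lift_sub B]) simp
qed (rule \<Delta> A_sub)+

lemma lift_sub_pr:
  assumes dg: "(d, g) \<in> \<sigma>" and x: "(x, x') \<in> E g"
  shows "(pr d x, pr g x) \<in> \<sigma>A"
proof -
  have d: "(d, d) \<in> \<Delta>" using secD(1)[OF \<sigma> dg] .
  have "(x, x) \<in> E' d"
    unfolding E_sub[OF dg] using is_perD(3)[OF famD(2)[OF famE secD(3)[OF \<sigma> dg dg]] x] .
  then show ?thesis using d dg by (auto simp: pairR_def wkR_def vzR_def extR_def)
qed

lemma PiFam_sub:
  assumes dg: "(d, g) \<in> \<sigma>"
  shows "PiFam E' (ElP k (\<sigma>A O B)) d = PiFam E G g"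
  unfolding PiFam_def E_sub[OF dg]
  by (rule PiPER_cong) (rule ElP_comp[OF sec_lift_sub B lift_sub_pr[OF dg]])

lemma PiR_sub: "\<sigma> O PiR l A k B = PiR l (\<sigma> O A) k (\<sigma>A O B)"
proof (rule sec_eqI)
  show "sec \<Delta> (\<lambda>_. UPER (max l k)) (\<sigma> O PiR l A k B)" by (rule sec_comp[OF \<sigma> sec_PiR]) simp
  show "sec \<Delta> (\<lambda>_. UPER (max l k)) (PiR l (\<sigma> O A) k (\<sigma>A O B))"
    by (rule pi_data.sec_PiR[OF pi_data_sub])
  show "\<sigma> O PiR l A k B \<subseteq> PiR l (\<sigma> O A) k (\<sigma>A O B)"
    by (auto simp: PiR_def PiFam_sub)
qed

lemma lamR_sub:
  assumes t: "sec \<Gamma>A G t"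
  shows "\<sigma> O lamR l A t = lamR l (\<sigma> O A) (\<sigma>A O t)"
proof (rule sec_eqI)
  show "sec \<Delta> (PiFam E' (ElP k (\<sigma>A O B))) (\<sigma> O lamR l A t)"
    by (rule sec_comp[OF \<sigma> sec_lamR[OF t] PiFam_sub])
  show "sec \<Delta> (PiFam E' (ElP k (\<sigma>A O B))) (lamR l (\<sigma> O A) (\<sigma>A O t))"
    by (rule pi_data.sec_lamR[OF pi_data_sub sec_comp[OF sec_lift_sub t ElP_comp[OF sec_lift_sub B]]])
  show "\<sigma> O lamR l A t \<subseteq> lamR l (\<sigma> O A) (\<sigma>A O t)"
  proof clarify
    fix d g f assume dg: "(d, g) \<in> \<sigma>" and f: "(g, f) \<in> lamR l A t"
    then show "(d, f) \<in> lamR l (\<sigma> O A) (\<sigma>A O t)"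
      unfolding lamR_def mem_Collect_eq case_prod_conv E_sub[OF dg]
      by (blast intro: relcompI lift_sub_pr[OF dg])
  qed
qed

end

end

section \<open>Universes and lifts\<close>

definition UR :: "per \<Rightarrow> nat \<Rightarrow> per" where
  "UR \<Gamma> l = {(g, c). (g, g) \<in> \<Gamma> \<and> Den (Suc l) c (UPER l)}"

definition LiftR :: "nat \<Rightarrow> per \<Rightarrow> per" where
  "LiftR l A = {(g, c). g \<in> Domain A \<and> Den (Suc l) c (ElP l A g)}"

lemma sec_UR:
  assumes "is_per \<Gamma>"
  shows "sec \<Gamma> (\<lambda>_. UPER (Suc l)) (UR \<Gamma> l)"
proof (rule secI)
  show "good (\<lambda>_. {UTag (Suc (Suc l))})" by (rule good_const)
  fix g c g' c'
  assume c: "(g, c) \<in> UR \<Gamma> l" and g: "(g, g') \<in> \<Gamma>" and e: "(c, c') \<in> UPER (Suc l)"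
  from c have "Den (Suc l) c (UPER l)" by (simp add: UR_def)
  with e have "Den (Suc l) c' (UPER l)" using Den_det unfolding UPER_def[of "Suc l"] by blast
  then show "(g', c') \<in> UR \<Gamma> l" using is_perD(4)[OF assms g] by (simp add: UR_def)
next
  fix g c c' assume "(g, c) \<in> UR \<Gamma> l" "(g, c') \<in> UR \<Gamma> l"
  then show "(c, c') \<in> UPER (Suc l)" unfolding UPER_def[of "Suc l"] UR_def by blast
next
  fix g c
  show "(g, g) \<in> \<Gamma>" if "(g, c) \<in> UR \<Gamma> l" using that by (simp add: UR_def)
  show "(g, {UTag (Suc (Suc l))}) \<in> UR \<Gamma> l" if "(g, g) \<in> \<Gamma>"
    using that Den_UPER by (simp add: UR_def del: Den.simps)
qed

lemma ElP_UR: "is_per \<Gamma> \<Longrightarrow> (g, g) \<in> \<Gamma> \<Longrightarrow> ElP (Suc l) (UR \<Gamma> l) g = UPER l"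
  by (rule ElP_eqI[OF sec_UR _ Den_UPER]) (simp_all add: UR_def Den_UPER del: Den.simps)

lemma sec_ElP_UR: "is_per \<Gamma> \<Longrightarrow> sec \<Gamma> (ElP (Suc l) (UR \<Gamma> l)) r \<longleftrightarrow> sec \<Gamma> (\<lambda>_. UPER l) r"
  using sec_cong[of \<Gamma> "ElP (Suc l) (UR \<Gamma> l)" "\<lambda>_. UPER l"]
    sec_cong[of \<Gamma> "\<lambda>_. UPER l" "ElP (Suc l) (UR \<Gamma> l)"] ElP_UR by auto

lemma UR_sub:
  assumes "is_per \<Delta>" "is_per \<Gamma>" and \<sigma>: "sec \<Delta> (\<lambda>_. \<Gamma>) \<sigma>"
  shows "\<sigma> O UR \<Gamma> l = UR \<Delta> l"
proof (rule sec_eqI)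
  show "sec \<Delta> (\<lambda>_. UPER (Suc l)) (\<sigma> O UR \<Gamma> l)" by (rule sec_comp[OF \<sigma> sec_UR[OF assms(2)]]) simp
  show "sec \<Delta> (\<lambda>_. UPER (Suc l)) (UR \<Delta> l)" by (rule sec_UR[OF assms(1)])
  show "\<sigma> O UR \<Gamma> l \<subseteq> UR \<Delta> l" using secD(1)[OF \<sigma>] unfolding UR_def by blast
qed

lemma sec_LiftR:
  assumes \<Gamma>: "is_per \<Gamma>" and A: "sec \<Gamma> (\<lambda>_. UPER l) A"
  shows "sec \<Gamma> (\<lambda>_. UPER (Suc l)) (LiftR l A)"
proof -
  obtain F where F: "good F" "\<And>g. (g, g) \<in> \<Gamma> \<Longrightarrow> (g, F g) \<in> A" by (rule sec_realizer[OF A]) blast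
  show ?thesis
  proof (rule secI)
    show "good (\<lambda>g. Up ` F g)" by (rule good_comp[OF good_image F(1)]) simp
    fix g c c'
    show "(g, g) \<in> \<Gamma>" if "(g, c) \<in> LiftR l A"
      using that sec_Domain[OF A] by (simp add: LiftR_def del: Den.simps)
    show "(g, Up ` F g) \<in> LiftR l A" if "(g, g) \<in> \<Gamma>"
      using Den_lift[OF Den_ElP[OF A F(2)[OF that]]] that sec_Domain[OF A]
      by (simp add: LiftR_def del: Den.simps)
    show "(g', c') \<in> LiftR l A"
      if c: "(g, c) \<in> LiftR l A" and g: "(g, g') \<in> \<Gamma>" and e: "(c, c') \<in> UPER (Suc l)" for g'
    proof -
      have "Den (Suc l) c (ElP l A g)" using c by (simp add: LiftR_def del: Den.simps)
      with e have "Den (Suc l) c' (ElP l A g)" using Den_det unfolding UPER_def[of "Suc l"] by blast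
      then show ?thesis
        using famD(3)[OF fam_ElP[OF \<Gamma> A] g] is_perD(4)[OF \<Gamma> g] sec_Domain[OF A]
        by (simp add: LiftR_def del: Den.simps)
    qed
    show "(c, c') \<in> UPER (Suc l)" if "(g, c) \<in> LiftR l A" "(g, c') \<in> LiftR l A"
      using that unfolding LiftR_def UPER_def[of "Suc l"] by blast
  qed
qed

lemma ElP_LiftR:
  assumes \<Gamma>: "is_per \<Gamma>" and A: "sec \<Gamma> (\<lambda>_. UPER l) A" and g: "(g, g) \<in> \<Gamma>"
  shows "ElP (Suc l) (LiftR l A) g = ElP l A g"
proof -
  obtain c where c: "(g, c) \<in> LiftR l A" using sec_ex[OF sec_LiftR[OF \<Gamma> A] g] by blast
  show ?thesis
    by (rule ElP_eqI[OF sec_LiftR[OF \<Gamma> A] c]) (use c in \<open>simp add: LiftR_def del: Den.simps\<close>)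
qed

text \<open>For this reason \<open>up\<close> and \<open>down\<close> touch nothing but the level
  tag: the isomorphism of cumulativity is the identity on relations.\<close>

lemma sec_ElP_LiftR:
  assumes "is_per \<Gamma>" "sec \<Gamma> (\<lambda>_. UPER l) A"
  shows "sec \<Gamma> (ElP (Suc l) (LiftR l A)) r \<longleftrightarrow> sec \<Gamma> (ElP l A) r"
  using sec_cong[of \<Gamma> "ElP (Suc l) (LiftR l A)" "ElP l A"]
    sec_cong[of \<Gamma> "ElP l A" "ElP (Suc l) (LiftR l A)"] ElP_LiftR[OF assms] by auto

lemma LiftR_sub:
  assumes "is_per \<Delta>" "is_per \<Gamma>" and \<sigma>: "sec \<Delta> (\<lambda>_. \<Gamma>) \<sigma>" and A: "sec \<Gamma> (\<lambda>_. UPER l) A"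
  shows "\<sigma> O LiftR l A = LiftR l (\<sigma> O A)"
proof (rule sec_eqI)
  show "sec \<Delta> (\<lambda>_. UPER (Suc l)) (\<sigma> O LiftR l A)"
    by (rule sec_comp[OF \<sigma> sec_LiftR[OF assms(2) A]]) simp
  show "sec \<Delta> (\<lambda>_. UPER (Suc l)) (LiftR l (\<sigma> O A))"
    by (rule sec_LiftR[OF assms(1) sec_comp[OF \<sigma> A]]) simp
  show "\<sigma> O LiftR l A \<subseteq> LiftR l (\<sigma> O A)"
    using ElP_comp[OF \<sigma> A] by (auto simp: LiftR_def simp del: Den.simps)
qed

section \<open>The model and its laws\<close>

text \<open>Types and terms are tagged with the level of the type, because \<open>Lift\<close>, \<open>Pi\<close> and \<open>El\<close> are
  not told it; contexts and substitutions get the tag 0.  On relations, \<open>code\<close> and \<open>El\<close> are the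
  identity: a type is a section of the universe.\<close>

type_synonym obj = "nat \<times> per"

abbreviation ElO :: "obj \<Rightarrow> rlz \<Rightarrow> per" where
  "ElO A \<equiv> ElP (fst A) (snd A)"

text \<open>All four sorts share the type \<open>obj\<close>, so that one closure can produce the
  countable submodel. \<open>UNIV\<close> serves as the empty context because it has a single class;
  \<open>comp\<close> swaps its arguments because \<open>O\<close> composes in diagrammatic
  order.\<close>

definition per_model :: "(obj, obj, obj, obj) dtt_struct" where
  "per_model = \<lparr>
    con = {\<Gamma>. is_per (snd \<Gamma>)},
    sub = (\<lambda>\<Delta> \<Gamma>. {\<sigma>. fst \<sigma> = 0 \<and> is_per (snd \<Delta>) \<and> is_per (snd \<Gamma>) \<and> sec (snd \<Delta>) (\<lambda>_. snd \<Gamma>) (snd \<sigma>)}),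
    ty = (\<lambda>l \<Gamma>. {A. fst A = l \<and> is_per (snd \<Gamma>) \<and> sec (snd \<Gamma>) (\<lambda>_. UPER l) (snd A)}),
    tm = (\<lambda>\<Gamma> A. {t. fst t = fst A \<and> sec (snd \<Gamma>) (ElO A) (snd t)}),
    sid = (\<lambda>\<Gamma>. (0, snd \<Gamma>)),
    comp = (\<lambda>\<sigma> \<tau>. (0, snd \<tau> O snd \<sigma>)),
    tsub = (\<lambda>A \<sigma>. (fst A, snd \<sigma> O snd A)),
    msub = (\<lambda>t \<sigma>. (fst t, snd \<sigma> O snd t)),
    emp = (0, UNIV),
    eps = (\<lambda>\<Gamma>. (0, {(g, x). (g, g) \<in> snd \<Gamma>})),
    ext = (\<lambda>\<Gamma> A. (0, extR (snd \<Gamma>) (ElO A))),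
    wk = (\<lambda>\<Gamma> A. (0, wkR (snd \<Gamma>) (ElO A))),
    vz = (\<lambda>\<Gamma> A. (fst A, vzR (snd \<Gamma>) (ElO A))),
    pair = (\<lambda>\<sigma> t. (0, pairR (snd \<sigma>) (snd t))),
    Pi = (\<lambda>A B. (max (fst A) (fst B), PiR (fst A) (snd A) (fst B) (snd B))),
    lam = (\<lambda>A B t. (max (fst A) (fst B), lamR (fst A) (snd A) (snd t))),
    app = (\<lambda>A B f. (fst B, appR (fst B) (snd B) (snd f))),
    Univ = (\<lambda>\<Gamma> l. (Suc l, UR (snd \<Gamma>) l)),
    code = (\<lambda>A. (Suc (fst A), snd A)),
    El = (\<lambda>a. (fst a - 1, snd a)),
    Lift = (\<lambda>A. (Suc (fst A), LiftR (fst A) (snd A))),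
    up = (\<lambda>t. (Suc (fst t), snd t)),
    down = (\<lambda>A t. (fst A, snd t))\<rparr>"

lemma per_model_simps [simp]:
  "con per_model = {\<Gamma>. is_per (snd \<Gamma>)}"
  "sub per_model \<Delta> \<Gamma> = {\<sigma>. fst \<sigma> = 0 \<and> is_per (snd \<Delta>) \<and> is_per (snd \<Gamma>) \<and> sec (snd \<Delta>) (\<lambda>_. snd \<Gamma>) (snd \<sigma>)}"
  "ty per_model l \<Gamma> = {A. fst A = l \<and> is_per (snd \<Gamma>) \<and> sec (snd \<Gamma>) (\<lambda>_. UPER l) (snd A)}"
  "tm per_model \<Gamma> A = {t. fst t = fst A \<and> sec (snd \<Gamma>) (ElO A) (snd t)}"
  "sid per_model \<Gamma> = (0, snd \<Gamma>)"
  "comp per_model \<sigma> \<tau> = (0, snd \<tau> O snd \<sigma>)"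
  "tsub per_model A \<sigma> = (fst A, snd \<sigma> O snd A)"
  "msub per_model t \<sigma> = (fst t, snd \<sigma> O snd t)"
  "emp per_model = (0, UNIV)"
  "eps per_model \<Gamma> = (0, {(g, x). (g, g) \<in> snd \<Gamma>})"
  "ext per_model \<Gamma> A = (0, extR (snd \<Gamma>) (ElO A))"
  "wk per_model \<Gamma> A = (0, wkR (snd \<Gamma>) (ElO A))"
  "vz per_model \<Gamma> A = (fst A, vzR (snd \<Gamma>) (ElO A))"
  "pair per_model \<sigma> t = (0, pairR (snd \<sigma>) (snd t))"
  "Pi per_model A B = (max (fst A) (fst B), PiR (fst A) (snd A) (fst B) (snd B))"
  "lam per_model A B t = (max (fst A) (fst B), lamR (fst A) (snd A) (snd t))"
  "app per_model A B f = (fst B, appR (fst B) (snd B) (snd f))"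
  "Univ per_model \<Gamma> l = (Suc l, UR (snd \<Gamma>) l)"
  "code per_model A = (Suc (fst A), snd A)"
  "El per_model a = (fst a - 1, snd a)"
  "Lift per_model A = (Suc (fst A), LiftR (fst A) (snd A))"
  "up per_model t = (Suc (fst t), snd t)"
  "down per_model A t = (fst A, snd t)"
  by (simp_all add: per_model_def)

lemma sec_comp_const: "sec \<Delta> (\<lambda>_. \<Gamma>) \<sigma> \<Longrightarrow> sec \<Gamma> (\<lambda>_. U) r \<Longrightarrow> sec \<Delta> (\<lambda>_. U) (\<sigma> O r)"
  by (erule (1) sec_comp) (rule refl)

lemma sec_comp_ElP:
  "sec \<Delta> (\<lambda>_. \<Gamma>) \<sigma> \<Longrightarrow> sec \<Gamma> (\<lambda>_. UPER l) A \<Longrightarrow> sec \<Gamma> (ElP l A) t \<Longrightarrow>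
    sec \<Delta> (ElP l (\<sigma> O A)) (\<sigma> O t)"
  by (rule sec_comp) (assumption | rule ElP_comp)+

lemma cwf_base_per_model: "cwf_base per_model"
  unfolding cwf_base_def
  by (auto simp: prod_eq_iff sec_id O_assoc
      intro: sec_comp_const sec_comp_ElP intro!: sec_id_comp sec_comp_id)

text \<open>\<open>sec_vzR\<close> places the variable in the fibre over \<open>prl z\<close>; this
  recasts it as the fibre of the weakened type, as the typing of \<open>vz\<close> requires.\<close>

lemma sec_vzR_ElP:
  assumes "is_per \<Gamma>" "sec \<Gamma> (\<lambda>_. UPER l) A"
  shows "sec (extR \<Gamma> (ElP l A)) (ElP l (wkR \<Gamma> (ElP l A) O A)) (vzR \<Gamma> (ElP l A))"
proof (rule sec_cong[OF _ sec_vzR])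
  show fam: "fam \<Gamma> (ElP l A)" using assms by (rule fam_ElP)
  fix z assume "(z, z) \<in> extR \<Gamma> (ElP l A)"
  then have "(z, prl z) \<in> wkR \<Gamma> (ElP l A)" by (simp add: wkR_def extR_def)
  then show "ElP l A (prl z) = ElP l (wkR \<Gamma> (ElP l A) O A) z"
    by (rule ElP_comp[OF sec_wkR[OF fam] assms(2), symmetric])
qed

lemma is_per_UNIV: "is_per UNIV"
  by (simp add: is_per_def sym_def trans_def)

lemma sec_eps: "is_per \<Gamma> \<Longrightarrow> sec \<Gamma> (\<lambda>_. UNIV) {(g, x). (g, g) \<in> \<Gamma>}"
  by (rule secI[OF _ _ _ good_id]) (simp_all add: is_perD(4))

lemma sec_UNIV: "sec \<Gamma> (\<lambda>_. UNIV) r \<Longrightarrow> r = {(g, x). (g, g) \<in> \<Gamma>}"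
  using secD(1,2) sec_ex by fast

lemma cwf_ctx_per_model: "cwf_ctx per_model"
  unfolding cwf_ctx_def
proof (intro conjI allI impI)
  show "emp per_model \<in> con per_model" by (simp add: is_per_UNIV)
next
  fix \<Gamma> assume "\<Gamma> \<in> con per_model"
  then show "eps per_model \<Gamma> \<in> sub per_model \<Gamma> (emp per_model)"
    by (simp add: is_per_UNIV sec_eps)
next
  fix \<Gamma> \<sigma> assume "\<sigma> \<in> sub per_model \<Gamma> (emp per_model)"
  then show "\<sigma> = eps per_model \<Gamma>" using sec_UNIV by (simp add: prod_eq_iff)
next
  fix l \<Gamma> A assume "A \<in> ty per_model l \<Gamma>"
  then have A: "is_per (snd \<Gamma>)" "sec (snd \<Gamma>) (\<lambda>_. UPER l) (snd A)" "fst A = l" by simp_all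
  note fam = fam_ElP[OF A(1,2)]
  show "ext per_model \<Gamma> A \<in> con per_model" using is_per_extR[OF fam] A by simp
  show "wk per_model \<Gamma> A \<in> sub per_model (ext per_model \<Gamma> A) \<Gamma>"
    using is_per_extR[OF fam] sec_wkR[OF fam] A by simp
  show "vz per_model \<Gamma> A \<in> tm per_model (ext per_model \<Gamma> A) (tsub per_model A (wk per_model \<Gamma> A))"
    using sec_vzR_ElP A by simp
  show "pair per_model (wk per_model \<Gamma> A) (vz per_model \<Gamma> A) = sid per_model (ext per_model \<Gamma> A)"
    using pairR_wkR_vzR[OF fam] A by simp
next
  fix l \<Delta> \<Gamma> A \<sigma> t
  assume "A \<in> ty per_model l \<Gamma> \<and> \<sigma> \<in> sub per_model \<Delta> \<Gamma> \<and> t \<in> tm per_model \<Delta> (tsub per_model A \<sigma>)"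
  then have A: "is_per (snd \<Gamma>)" "sec (snd \<Gamma>) (\<lambda>_. UPER l) (snd A)" "fst A = l"
    and \<sigma>: "is_per (snd \<Delta>)" "sec (snd \<Delta>) (\<lambda>_. snd \<Gamma>) (snd \<sigma>)" "fst \<sigma> = 0"
    and t: "sec (snd \<Delta>) (ElP l (snd \<sigma> O snd A)) (snd t)" "fst t = l" by auto
  note fam = fam_ElP[OF A(1,2)] and E = ElP_comp[OF \<sigma>(2) A(2)]
  show "pair per_model \<sigma> t \<in> sub per_model \<Delta> (ext per_model \<Gamma> A)"
    using sec_pairR[OF \<sigma>(2) t(1) E] is_per_extR[OF fam] A \<sigma> by simp
  show "comp per_model (wk per_model \<Gamma> A) (pair per_model \<sigma> t) = \<sigma>"
    using pairR_wkR[OF \<sigma>(2) t(1) E] A \<sigma> by (simp add: prod_eq_iff)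
  show "msub per_model (vz per_model \<Gamma> A) (pair per_model \<sigma> t) = t"
    using pairR_vzR[OF \<sigma>(2) t(1) E] A t by (simp add: prod_eq_iff)
next
  fix l \<Theta> \<Delta> \<Gamma> A \<sigma> t \<tau>
  assume "A \<in> ty per_model l \<Gamma> \<and> \<sigma> \<in> sub per_model \<Delta> \<Gamma> \<and> t \<in> tm per_model \<Delta> (tsub per_model A \<sigma>) \<and>
      \<tau> \<in> sub per_model \<Theta> \<Delta>"
  then have "sec (snd \<Theta>) (\<lambda>_. snd \<Delta>) (snd \<tau>)"
    "sec (snd \<Delta>) (ElP l (snd \<sigma> O snd A)) (snd t)" by auto
  then show "comp per_model (pair per_model \<sigma> t) \<tau> =
      pair per_model (comp per_model \<sigma> \<tau>) (msub per_model t \<tau>)"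
    using comp_pairR by simp
qed

lemma cwf_pi_per_model: "cwf_pi per_model"
  unfolding cwf_pi_def
proof (intro allI impI)
  fix l k \<Gamma> A B
  assume "A \<in> ty per_model l \<Gamma> \<and> B \<in> ty per_model k (ext per_model \<Gamma> A)"
  then have *: "is_per (snd \<Gamma>)" "sec (snd \<Gamma>) (\<lambda>_. UPER l) (snd A)"
    "sec (extR (snd \<Gamma>) (ElP l (snd A))) (\<lambda>_. UPER k) (snd B)"
    and [simp]: "fst A = l" "fst B = k" by auto
  then interpret pi_data "snd \<Gamma>" l k "snd A" "snd B" by unfold_locales
  show "Pi per_model A B \<in> ty per_model (max l k) \<Gamma> \<and>
    (\<forall>t. t \<in> tm per_model (ext per_model \<Gamma> A) B \<longrightarrow>
         lam per_model A B t \<in> tm per_model \<Gamma> (Pi per_model A B) \<and>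
         app per_model A B (lam per_model A B t) = t) \<and>
    (\<forall>f. f \<in> tm per_model \<Gamma> (Pi per_model A B) \<longrightarrow>
         app per_model A B f \<in> tm per_model (ext per_model \<Gamma> A) B \<and>
         lam per_model A B (app per_model A B f) = f) \<and>
    (\<forall>\<Delta> \<sigma>. \<sigma> \<in> sub per_model \<Delta> \<Gamma> \<longrightarrow>
         tsub per_model (Pi per_model A B) \<sigma> =
           Pi per_model (tsub per_model A \<sigma>) (tsub per_model B (lift_sub per_model \<Delta> A \<sigma>)) \<and>
         (\<forall>t. t \<in> tm per_model (ext per_model \<Gamma> A) B \<longrightarrow>
            msub per_model (lam per_model A B t) \<sigma> =
              lam per_model (tsub per_model A \<sigma>) (tsub per_model B (lift_sub per_model \<Delta> A \<sigma>))
                    (msub per_model t (lift_sub per_model \<Delta> A \<sigma>))))"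
    using * by (auto simp: lift_sub_def prod_eq_iff sec_PiFam sec_PiR sec_lamR sec_appR
        app_lam lam_app PiR_sub lamR_sub)
qed

lemma cwf_univ_per_model: "cwf_univ per_model"
  unfolding cwf_univ_def
  by (auto simp: prod_eq_iff sec_UR UR_sub sec_ElP_UR)

lemma cwf_lift_per_model: "cwf_lift per_model"
  unfolding cwf_lift_def
proof (intro allI impI)
  fix l \<Gamma> A assume "A \<in> ty per_model l \<Gamma>"
  then have A: "is_per (snd \<Gamma>)" "sec (snd \<Gamma>) (\<lambda>_. UPER l) (snd A)" and [simp]: "fst A = l"
    by auto
  have "\<forall>\<Delta> \<sigma>. is_per \<Delta> \<and> sec \<Delta> (\<lambda>_. snd \<Gamma>) \<sigma> \<longrightarrow> \<sigma> O LiftR l (snd A) = LiftR l (\<sigma> O snd A)"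
    using LiftR_sub[OF _ A(1) _ A(2)] by blast
  then show "Lift per_model A \<in> ty per_model (Suc l) \<Gamma> \<and>
    (\<forall>t. t \<in> tm per_model \<Gamma> A \<longrightarrow>
       up per_model t \<in> tm per_model \<Gamma> (Lift per_model A) \<and> down per_model A (up per_model t) = t) \<and>
    (\<forall>t. t \<in> tm per_model \<Gamma> (Lift per_model A) \<longrightarrow>
       down per_model A t \<in> tm per_model \<Gamma> A \<and> up per_model (down per_model A t) = t) \<and>
    (\<forall>\<Delta> \<sigma>. \<sigma> \<in> sub per_model \<Delta> \<Gamma> \<longrightarrow>
       tsub per_model (Lift per_model A) \<sigma> = Lift per_model (tsub per_model A \<sigma>) \<and>
       (\<forall>t. t \<in> tm per_model \<Gamma> A \<longrightarrow>
          msub per_model (up per_model t) \<sigma> = up per_model (msub per_model t \<sigma>)))"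
    using A by (simp add: prod_eq_iff sec_LiftR sec_ElP_LiftR)
qed

lemma dtt_model_per_model: "dtt_model per_model"
  unfolding dtt_model_def
  using cwf_base_per_model cwf_ctx_per_model cwf_pi_per_model cwf_univ_per_model cwf_lift_per_model
  by blast

section \<open>An empty type, and constancy of functions on universes\<close>

definition empty_ty :: obj where
  "empty_ty = (0, {(g, c). Den 0 c {}})"

text \<open>The empty context has points, and a section would have to supply an element of the empty
  PER at each of them.\<close>

lemma empty_ty:
  "empty_ty \<in> ty per_model 0 (emp per_model)" "tm per_model (emp per_model) empty_ty = {}"
proof -
  have s: "sec UNIV (\<lambda>_. UPER 0) {(g, c). Den 0 c {}}"
  proof (rule secI[OF _ _ _ good_const])
    fix g a g' a' assume "(g, a) \<in> {(g, c). Den 0 c {}}" "(a, a') \<in> UPER 0"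
    then show "(g', a') \<in> {(g, c). Den 0 c {}}"
      using Den_det unfolding UPER_def by blast
  next
    show "(g, {}) \<in> {(g, c). Den 0 c {}}" for g :: rlz using Den_empty by simp
  qed (auto simp: UPER_def)
  then show "empty_ty \<in> ty per_model 0 (emp per_model)"
    by (simp add: empty_ty_def is_per_UNIV)
  have "ElP 0 {(g, c). Den 0 c {}} g = {}" for g
    by (rule ElP_eqI[OF s _ Den_empty]) (use Den_empty in simp)
  then have "\<not> sec UNIV (ElP 0 {(g, c). Den 0 c {}}) t" for t
    using sec_ex[of UNIV _ t] secD(3)[of UNIV _ t] by fastforce
  then show "tm per_model (emp per_model) empty_ty = {}" by (simp add: empty_ty_def)
qed

lemma universe_functions_constant_per_model: "universe_functions_constant per_model"
  unfolding universe_functions_constant_def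
proof (intro allI impI, elim conjE)
  fix l \<Gamma> a f X Y
  let ?B = "tsub per_model (El per_model a) (wk per_model \<Gamma> (Univ per_model \<Gamma> l))"
  assume "\<Gamma> \<in> con per_model" and a': "a \<in> tm per_model \<Gamma> (Univ per_model \<Gamma> l)"
    and f': "f \<in> tm per_model \<Gamma> (Pi per_model (Univ per_model \<Gamma> l) ?B)"
    and XY: "X \<in> tm per_model \<Gamma> (Univ per_model \<Gamma> l)" "Y \<in> tm per_model \<Gamma> (Univ per_model \<Gamma> l)"
  then have \<Gamma>: "is_per (snd \<Gamma>)" by simp
  have a: "sec (snd \<Gamma>) (\<lambda>_. UPER l) (snd a)" "fst a = Suc l"
    using a' \<Gamma> by (simp_all add: sec_ElP_UR)
  have X: "sec (snd \<Gamma>) (\<lambda>_. UPER l) (snd X)" and Y: "sec (snd \<Gamma>) (\<lambda>_. UPER l) (snd Y)"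
    using XY \<Gamma> by (simp_all add: sec_ElP_UR)
  let ?U = "UR (snd \<Gamma>) l" and ?E = "ElP (Suc l) (UR (snd \<Gamma>) l)"
  let ?b = "wkR (snd \<Gamma>) ?E O snd a"
  have wk: "sec (extR (snd \<Gamma>) ?E) (\<lambda>_. snd \<Gamma>) (wkR (snd \<Gamma>) ?E)"
    by (rule sec_wkR[OF fam_ElP[OF \<Gamma> sec_UR[OF \<Gamma>]]])
  interpret pi_data "snd \<Gamma>" "Suc l" l ?U ?b
    by unfold_locales (use \<Gamma> sec_UR[OF \<Gamma>] sec_comp_const[OF wk a(1)] in auto)
  have f: "sec (snd \<Gamma>) (PiFam ?E (ElP l ?b)) (snd f)"
    using f' a(2) sec_PiFam by simp
  \<comment> \<open>The codomain is weakened from \<open>\<Gamma>\<close>, so its fibre ignores the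
    code \<open>c\<close>: here it matters that the target is a fixed type.\<close>
  have b: "ElP l ?b (pr g c) = ElP l (snd a) g" if "(g, g) \<in> snd \<Gamma>" "(c, c) \<in> UPER l" for g c
    by (rule ElP_comp[OF wk a(1)])
      (use that ElP_UR[OF \<Gamma> that(1)] in \<open>simp add: wkR_def extR_def\<close>)
  \<comment> \<open>Stated for arbitrary \<open>X\<close> and \<open>Y\<close>, so that exchanging
    them yields the converse inclusion.\<close>
  have sub: "pairR (snd \<Gamma>) (snd X) O appR l ?b (snd f) \<subseteq> pairR (snd \<Gamma>) (snd Y) O appR l ?b (snd f)"
    if X: "sec (snd \<Gamma>) (\<lambda>_. UPER l) (snd X)" and Y: "sec (snd \<Gamma>) (\<lambda>_. UPER l) (snd Y)" for X Y :: obj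
  proof clarify
    fix g z v assume z: "(g, z) \<in> pairR (snd \<Gamma>) (snd X)" "(z, v) \<in> appR l ?b (snd f)"
    then obtain h where h: "(prl z, h) \<in> snd f" "(h \<cdot> prr z, v) \<in> ElP l ?b z"
      by (auto simp: appR_def)
    have gz: "(g, prl z) \<in> snd \<Gamma>" "(g, prr z) \<in> snd X" using z(1) by (simp_all add: pairR_def)
    have g: "(g, g) \<in> snd \<Gamma>" using is_perD(3)[OF \<Gamma> gz(1)] .
    have x: "(prr z, prr z) \<in> UPER l" using secD(3)[OF X gz(2,2)] .
    obtain y where y: "(g, y) \<in> snd Y" using sec_ex[OF Y g] by blast
    have yy: "(y, y) \<in> UPER l" using secD(3)[OF Y y y] .
    have hg: "(g, h) \<in> snd f" using sec_move[OF f h(1) is_perD(1)[OF \<Gamma> gz(1)]] .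
    obtain d where d: "(g, d) \<in> snd a" using sec_ex[OF a(1) g] by blast
    note A = Den_ElP[OF a(1) d]
    \<comment> \<open>After moving to the point \<open>g\<close>, one realizer \<open>h\<close>
      serves both arguments, and \<open>UPER_const\<close> compares its two values.\<close>
    have "(h \<cdot> prr z, h \<cdot> y) \<in> ElP l (snd a) g"
    proof (rule UPER_const[OF A _ x yy])
      fix c c' assume c: "(c, c') \<in> UPER l"
      then have "(h \<cdot> c, h \<cdot> c') \<in> ElP l ?b (pr g c)"
        using secD(3)[OF f hg hg] ElP_UR[OF \<Gamma> g] by (auto simp: PiFam_def PiPER_def)
      then show "(h \<cdot> c, h \<cdot> c') \<in> ElP l (snd a) g"
        using b[OF g] is_perD(3)[OF is_per_UPER c] by simp
    qed
    moreover have "(h \<cdot> prr z, v) \<in> ElP l (snd a) g"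
    proof -
      have "(prl z, prl z) \<in> snd \<Gamma>" using is_perD(4)[OF \<Gamma> gz(1)] .
      then have "(z, g) \<in> wkR (snd \<Gamma>) ?E"
        using x is_perD(1)[OF \<Gamma> gz(1)] ElP_UR[OF \<Gamma>] by (simp add: wkR_def extR_def)
      from ElP_comp[OF wk a(1) this] show ?thesis using h(2) by simp
    qed
    ultimately have "(h \<cdot> y, v) \<in> ElP l ?b (pr g y)"
      using is_perD(1,2)[OF Den_is_per[OF A]] b[OF g yy] by blast
    then have "(pr g y, v) \<in> appR l ?b (snd f)" using hg by (auto simp: appR_def)
    moreover have "(g, pr g y) \<in> pairR (snd \<Gamma>) (snd Y)" using g y by (simp add: pairR_def)
    ultimately show "(g, v) \<in> pairR (snd \<Gamma>) (snd Y) O appR l ?b (snd f)" by blast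
  qed
  show "apply_tm per_model \<Gamma> (Univ per_model \<Gamma> l) ?B f X = apply_tm per_model \<Gamma> (Univ per_model \<Gamma> l) ?B f Y"
    using sub[OF X Y] sub[OF Y X] a(2) by (simp add: apply_tm_def)
qed

section \<open>A countable submodel\<close>

text \<open>Every axiom of a model is a universally quantified Horn clause, so the closure of a
  countable set under the operations is a countable submodel.\<close>

datatype expr =
    Atom nat
  | Emp
  | UnivE expr nat
  | SidE expr
  | CompE expr expr
  | TsubE expr expr
  | MsubE expr expr
  | EpsE expr
  | ExtE expr expr
  | WkE expr expr
  | VzE expr expr
  | PairE expr expr
  | PiE expr expr
  | LamE expr expr expr
  | AppE expr expr expr
  | CodeE expr
  | ElE expr
  | LiftE expr
  | UpE expr
  | DownE expr expr

instance expr :: countable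
  by countable_datatype

primrec ev ::
  "('a, 'a, 'a, 'a) dtt_struct \<Rightarrow> (nat \<Rightarrow> 'a) \<Rightarrow> expr \<Rightarrow> 'a" where
  "ev M a (Atom n) = a n"
| "ev M a Emp = emp M"
| "ev M a (UnivE x n) = Univ M (ev M a x) n"
| "ev M a (SidE x) = sid M (ev M a x)"
| "ev M a (CompE x y) = comp M (ev M a x) (ev M a y)"
| "ev M a (TsubE x y) = tsub M (ev M a x) (ev M a y)"
| "ev M a (MsubE x y) = msub M (ev M a x) (ev M a y)"
| "ev M a (EpsE x) = eps M (ev M a x)"
| "ev M a (ExtE x y) = ext M (ev M a x) (ev M a y)"
| "ev M a (WkE x y) = wk M (ev M a x) (ev M a y)"
| "ev M a (VzE x y) = vz M (ev M a x) (ev M a y)"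
| "ev M a (PairE x y) = pair M (ev M a x) (ev M a y)"
| "ev M a (PiE x y) = Pi M (ev M a x) (ev M a y)"
| "ev M a (LamE x y z) = lam M (ev M a x) (ev M a y) (ev M a z)"
| "ev M a (AppE x y z) = app M (ev M a x) (ev M a y) (ev M a z)"
| "ev M a (CodeE x) = code M (ev M a x)"
| "ev M a (ElE x) = El M (ev M a x)"
| "ev M a (LiftE x) = Lift M (ev M a x)"
| "ev M a (UpE x) = up M (ev M a x)"
| "ev M a (DownE x y) = down M (ev M a x) (ev M a y)"

text \<open>\<open>g\<close> decodes numbers and \<open>h\<close> encodes elements. Typing is taken
  from \<open>M\<close> as it is: since \<open>g\<close> hits only elements of the submodel, the
  restriction happens by itself.\<close>

definition pull_back ::
  "('a, 'a, 'a, 'a) dtt_struct \<Rightarrow> (nat \<Rightarrow> 'a) \<Rightarrow> ('a \<Rightarrow> nat) \<Rightarrow>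
    (nat, nat, nat, nat) dtt_struct" where
  "pull_back M g h = \<lparr>
    con = {x. g x \<in> con M},
    sub = (\<lambda>x y. {s. g s \<in> sub M (g x) (g y)}),
    ty = (\<lambda>l x. {s. g s \<in> ty M l (g x)}),
    tm = (\<lambda>x y. {s. g s \<in> tm M (g x) (g y)}),
    sid = (\<lambda>x. h (sid M (g x))),
    comp = (\<lambda>x y. h (comp M (g x) (g y))),
    tsub = (\<lambda>x y. h (tsub M (g x) (g y))),
    msub = (\<lambda>x y. h (msub M (g x) (g y))),
    emp = h (emp M),
    eps = (\<lambda>x. h (eps M (g x))),
    ext = (\<lambda>x y. h (ext M (g x) (g y))),
    wk = (\<lambda>x y. h (wk M (g x) (g y))),
    vz = (\<lambda>x y. h (vz M (g x) (g y))),
    pair = (\<lambda>x y. h (pair M (g x) (g y))),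
    Pi = (\<lambda>x y. h (Pi M (g x) (g y))),
    lam = (\<lambda>x y z. h (lam M (g x) (g y) (g z))),
    app = (\<lambda>x y z. h (app M (g x) (g y) (g z))),
    Univ = (\<lambda>x l. h (Univ M (g x) l)),
    code = (\<lambda>x. h (code M (g x))),
    El = (\<lambda>x. h (El M (g x))),
    Lift = (\<lambda>x. h (Lift M (g x))),
    up = (\<lambda>x. h (up M (g x))),
    down = (\<lambda>x y. h (down M (g x) (g y)))\<rparr>"

lemma pull_back_simps:
  "con (pull_back M g h) = {x. g x \<in> con M}"
  "sub (pull_back M g h) x y = {s. g s \<in> sub M (g x) (g y)}"
  "ty (pull_back M g h) l x = {s. g s \<in> ty M l (g x)}"
  "tm (pull_back M g h) x y = {s. g s \<in> tm M (g x) (g y)}"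
  "emp (pull_back M g h) = h (emp M)"
  "Univ (pull_back M g h) x l = h (Univ M (g x) l)"
  "sid (pull_back M g h) x = h (sid M (g x))"
  "comp (pull_back M g h) x y = h (comp M (g x) (g y))"
  "tsub (pull_back M g h) x y = h (tsub M (g x) (g y))"
  "msub (pull_back M g h) x y = h (msub M (g x) (g y))"
  "eps (pull_back M g h) x = h (eps M (g x))"
  "ext (pull_back M g h) x y = h (ext M (g x) (g y))"
  "wk (pull_back M g h) x y = h (wk M (g x) (g y))"
  "vz (pull_back M g h) x y = h (vz M (g x) (g y))"
  "pair (pull_back M g h) x y = h (pair M (g x) (g y))"
  "Pi (pull_back M g h) x y = h (Pi M (g x) (g y))"
  "lam (pull_back M g h) x y z = h (lam M (g x) (g y) (g z))"
  "app (pull_back M g h) x y z = h (app M (g x) (g y) (g z))"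
  "code (pull_back M g h) x = h (code M (g x))"
  "El (pull_back M g h) x = h (El M (g x))"
  "Lift (pull_back M g h) x = h (Lift M (g x))"
  "up (pull_back M g h) x = h (up M (g x))"
  "down (pull_back M g h) x y = h (down M (g x) (g y))"
  by (simp_all add: pull_back_def)

text \<open>Closure covers ill-typed arguments as well, since the operations are total; no typing
  enters the transfer.\<close>

locale substructure =
  fixes M :: "('a, 'a, 'a, 'a) dtt_struct"
    and g :: "nat \<Rightarrow> 'a" and h :: "'a \<Rightarrow> nat" and S :: "'a set"
  assumes g_in [simp]: "\<And>n. g n \<in> S"
    and h_g [simp]: "\<And>n. h (g n) = n"
    and g_h [simp]: "\<And>x. x \<in> S \<Longrightarrow> g (h x) = x"
    and emp_in: "emp M \<in> S"
    and Univ_in: "\<And>x l. x \<in> S \<Longrightarrow> Univ M x l \<in> S"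
    and sid_in: "\<And>x. x \<in> S \<Longrightarrow> sid M x \<in> S"
    and comp_in: "\<And>x y. x \<in> S \<Longrightarrow> y \<in> S \<Longrightarrow> comp M x y \<in> S"
    and tsub_in: "\<And>x y. x \<in> S \<Longrightarrow> y \<in> S \<Longrightarrow> tsub M x y \<in> S"
    and msub_in: "\<And>x y. x \<in> S \<Longrightarrow> y \<in> S \<Longrightarrow> msub M x y \<in> S"
    and eps_in: "\<And>x. x \<in> S \<Longrightarrow> eps M x \<in> S"
    and ext_in: "\<And>x y. x \<in> S \<Longrightarrow> y \<in> S \<Longrightarrow> ext M x y \<in> S"
    and wk_in: "\<And>x y. x \<in> S \<Longrightarrow> y \<in> S \<Longrightarrow> wk M x y \<in> S"
    and vz_in: "\<And>x y. x \<in> S \<Longrightarrow> y \<in> S \<Longrightarrow> vz M x y \<in> S"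
    and pair_in: "\<And>x y. x \<in> S \<Longrightarrow> y \<in> S \<Longrightarrow> pair M x y \<in> S"
    and Pi_in: "\<And>x y. x \<in> S \<Longrightarrow> y \<in> S \<Longrightarrow> Pi M x y \<in> S"
    and lam_in: "\<And>x y z. x \<in> S \<Longrightarrow> y \<in> S \<Longrightarrow> z \<in> S \<Longrightarrow> lam M x y z \<in> S"
    and app_in: "\<And>x y z. x \<in> S \<Longrightarrow> y \<in> S \<Longrightarrow> z \<in> S \<Longrightarrow> app M x y z \<in> S"
    and code_in: "\<And>x. x \<in> S \<Longrightarrow> code M x \<in> S"
    and El_in: "\<And>x. x \<in> S \<Longrightarrow> El M x \<in> S"
    and Lift_in: "\<And>x. x \<in> S \<Longrightarrow> Lift M x \<in> S"
    and up_in: "\<And>x. x \<in> S \<Longrightarrow> up M x \<in> S"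
    and down_in: "\<And>x y. x \<in> S \<Longrightarrow> y \<in> S \<Longrightarrow> down M x y \<in> S"
begin

lemmas closed = emp_in Univ_in
  sid_in comp_in tsub_in msub_in eps_in ext_in
  wk_in vz_in pair_in Pi_in lam_in app_in
  code_in El_in Lift_in up_in down_in

text \<open>With this rule and the next, the simplifier turns each axiom of \<open>N\<close> into
  the axiom of \<open>M\<close> at elements \<open>g n\<close>.\<close>

lemma h_eq_iff: "x \<in> S \<Longrightarrow> y \<in> S \<Longrightarrow> h x = h y \<longleftrightarrow> x = y"
  by (metis g_h)

lemma h_eq_iff_left: "x \<in> S \<Longrightarrow> h x = n \<longleftrightarrow> x = g n"
  by (metis g_h h_g)

abbreviation "N \<equiv> pull_back M g h"

lemmas N_simps = pull_back_simps closed h_eq_iff h_eq_iff_left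

lemma lift_sub_N: "lift_sub N x y z = h (lift_sub M (g x) (g y) (g z))"
  by (simp add: lift_sub_def pull_back_simps closed)

lemma lift_sub_in: "x \<in> S \<Longrightarrow> y \<in> S \<Longrightarrow> z \<in> S \<Longrightarrow> lift_sub M x y z \<in> S"
  by (simp add: lift_sub_def closed)

lemma cwf_base_pull: "cwf_base M \<Longrightarrow> cwf_base N"
  unfolding cwf_base_def
  by (elim conjE, intro conjI; (simp add: N_simps)?; (intro allI impI)?; (elim conjE)?; blast?)

lemma cwf_ctx_pull: "cwf_ctx M \<Longrightarrow> cwf_ctx N"
  unfolding cwf_ctx_def
  by (elim conjE, intro conjI; (simp add: N_simps)?; blast?)

lemma cwf_pi_pull: "cwf_pi M \<Longrightarrow> cwf_pi N"
  unfolding cwf_pi_def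
  by (simp add: N_simps lift_sub_N lift_sub_in)

lemma cwf_univ_pull: "cwf_univ M \<Longrightarrow> cwf_univ N"
  unfolding cwf_univ_def
  by (elim conjE, intro conjI; (simp add: N_simps)?; blast?)

lemma cwf_lift_pull: "cwf_lift M \<Longrightarrow> cwf_lift N"
  unfolding cwf_lift_def
  by (simp add: N_simps)

lemma dtt_model_pull: "dtt_model M \<Longrightarrow> dtt_model N"
  unfolding dtt_model_def
  by (simp add: cwf_base_pull cwf_ctx_pull cwf_pi_pull cwf_univ_pull cwf_lift_pull)

text \<open>An existence statement does not pass to a submodel by itself, so the witness
  \<open>A\<close> must lie in \<open>S\<close>; its emptiness does pass, as no terms are
  added.\<close>

lemma nontrivial_model_pull:
  assumes "A \<in> S" "A \<in> ty M l (emp M)" "tm M (emp M) A = {}"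
  shows "nontrivial_model N"
  unfolding nontrivial_model_def
  by (intro exI[of _ l] exI[of _ "h A"]) (simp add: N_simps assms)

lemma universe_functions_constant_pull:
  "universe_functions_constant M \<Longrightarrow> universe_functions_constant N"
  unfolding universe_functions_constant_def apply_tm_def
  by (simp add: N_simps)

end

theorem mainTheorem1:
  shows "\<exists>M :: (nat, nat, nat, nat) dtt_struct.
           dtt_model M \<and> nontrivial_model M \<and> universe_functions_constant M"
proof -
  \<comment> \<open>The atoms beyond 0 serve only to make the submodel infinite, hence in bijection with \<open>nat\<close>.\<close>
  define a :: "nat \<Rightarrow> obj" where "a n = (case n of 0 \<Rightarrow> empty_ty | Suc k \<Rightarrow> (k, {}))" for n
  let ?S = "range (ev per_model a)"
  have in_S: "ev per_model a e \<in> ?S" for e by (rule rangeI)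
  have inj: "inj (\<lambda>n. ev per_model a (Atom (Suc n)))" by (simp add: a_def inj_on_def)
  have "infinite ?S"
    by (rule infinite_super[OF _ range_inj_infinite[OF inj]]) (intro image_subsetI in_S)
  moreover have "countable ?S" by simp
  ultimately have bij: "bij_betw (from_nat_into ?S) UNIV ?S" by (intro bij_betw_from_nat_into)
  interpret substructure per_model "from_nat_into ?S" "inv_into UNIV (from_nat_into ?S)" ?S
  proof
    show "from_nat_into ?S n \<in> ?S" for n by (rule from_nat_into) simp
    show "inv_into UNIV (from_nat_into ?S) (from_nat_into ?S n) = n" for n
      using bij by (simp add: bij_betw_def)
    show "from_nat_into ?S (inv_into UNIV (from_nat_into ?S) x) = x" if "x \<in> ?S" for x
      using bij that by (simp add: bij_betw_def f_inv_into_f)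
  next
    show "emp per_model \<in> ?S" using in_S[of Emp] by (simp only: ev.simps)
    fix x y z assume "x \<in> ?S" then obtain u where x: "x = ev per_model a u" by blast
    show "Univ per_model x l \<in> ?S" for l using in_S[of "UnivE u l"] by (simp only: ev.simps x)
    show "sid per_model x \<in> ?S"
      using in_S[of "SidE u"] by (simp only: ev.simps x)
    show "eps per_model x \<in> ?S"
      using in_S[of "EpsE u"] by (simp only: ev.simps x)
    show "code per_model x \<in> ?S"
      using in_S[of "CodeE u"] by (simp only: ev.simps x)
    show "El per_model x \<in> ?S"
      using in_S[of "ElE u"] by (simp only: ev.simps x)
    show "Lift per_model x \<in> ?S"
      using in_S[of "LiftE u"] by (simp only: ev.simps x)
    show "up per_model x \<in> ?S"
      using in_S[of "UpE u"] by (simp only: ev.simps x)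
    assume "y \<in> ?S" then obtain v where y: "y = ev per_model a v" by blast
    show "comp per_model x y \<in> ?S"
      using in_S[of "CompE u v"] by (simp only: ev.simps x y)
    show "tsub per_model x y \<in> ?S"
      using in_S[of "TsubE u v"] by (simp only: ev.simps x y)
    show "msub per_model x y \<in> ?S"
      using in_S[of "MsubE u v"] by (simp only: ev.simps x y)
    show "ext per_model x y \<in> ?S"
      using in_S[of "ExtE u v"] by (simp only: ev.simps x y)
    show "wk per_model x y \<in> ?S"
      using in_S[of "WkE u v"] by (simp only: ev.simps x y)
    show "vz per_model x y \<in> ?S"
      using in_S[of "VzE u v"] by (simp only: ev.simps x y)
    show "pair per_model x y \<in> ?S"
      using in_S[of "PairE u v"] by (simp only: ev.simps x y)
    show "Pi per_model x y \<in> ?S"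
      using in_S[of "PiE u v"] by (simp only: ev.simps x y)
    show "down per_model x y \<in> ?S"
      using in_S[of "DownE u v"] by (simp only: ev.simps x y)
    assume "z \<in> ?S" then obtain w where z: "z = ev per_model a w" by blast
    show "lam per_model x y z \<in> ?S"
      using in_S[of "LamE u v w"] by (simp only: ev.simps x y z)
    show "app per_model x y z \<in> ?S"
      using in_S[of "AppE u v w"] by (simp only: ev.simps x y z)
  qed
  \<comment> \<open>\<open>Atom 0\<close> evaluates to \<open>empty_ty\<close>, so the witness of
    non-triviality lies in the closure.\<close>
  show ?thesis
    using dtt_model_pull[OF dtt_model_per_model]
      nontrivial_model_pull[OF _ empty_ty]
      universe_functions_constant_pull[OF universe_functions_constant_per_model]
      in_S[of "Atom 0"] by (auto simp: a_def)
qed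

end
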